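(* Let $k\ge 2$, $p\ge k$ and $n\ge 1$ be integers and put $r=p-k$. Let $\zeta_1,\dots,\zeta_p\in\mathbb{C}$ (not necessarily distinct) and $a_1,\dots,a_p>0$, and let $Q_2,Q_1\in\mathbb{C}[z]$ be the polynomials determined by $Q_2(z)=\prod_{l=1}^{p}(z-\zeta_l)$ and $\frac{Q_1(z)}{Q_2(z)}=\sum_{l=1}^{p}\frac{a_l}{z-\zeta_l}$. Suppose that $S,V\in\mathbb{C}[z]$ with $\deg S=n$ and $\deg V=r$ satisfy $$Q_2(z)S^{(k)}(z)+Q_1(z)S^{(k-1)}(z)+V(z)S(z)=0 .$$ Let $s_1,\dots,s_n$ and $v_1,\dots,v_{r}$ be the zeros of $S$ and $V$, respectively, listed with multiplicity, and put $\alpha_k=n-k+1+\sum_{l=1}^{p}a_l$. Then for every convex function $f:\mathbb{C}\to\mathbb{R}$ $$\sum_{i=1}^{r}f(v_i)+\left[1-\left(1-\frac{k-1}{n}\right)\left(1-\frac{1}{\alpha_k}\right)\right]\sum_{j=1}^{n}f(s_j)\le\sum_{l=1}^{p}\left(1-\frac{a_l}{\alpha_k}\right)f(\zeta_l),\qquad( * )$$ and if equality occurs in $( * )$ for some strictly convex function $f$ then $\zeta_1,\dots,\zeta_p$ are collinear. Equivalently to the validity of $( * )$ for all convex $f$, one has the weighted majorization relation $$\big((v_1,\dots,v_{r},s_1,\dots,s_n),\,\mathbf{a}_k\vee\mathbf{b}_k\big)\prec\big((\zeta_1,\dots,\zeta_p),\,\mathbf{c}_k\big),$$ where $$\mathbf{a}_k=\frac{\alpha_k}{(p-1)\alpha_k+n-k+1}\mathbf{1}_{r},\qquad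 \mathbf{b}_k=\frac{(k-1)\alpha_k+n-k+1}{n[(p-1)\alpha_k+n-k+1]}\mathbf{1}_n,$$ $$\mathbf{c}_k=\left(\frac{\alpha_k-a_1}{(p-1)\alpha_k+n-k+1},\dots,\frac{\alpha_k-a_p}{(p-1)\alpha_k+n-k+1}\right).$$ That is, there exists a row stochastic $(n+r)\times p$ matrix $R_k$ such that $$(v_1,\dots,v_{r},s_1,\dots,s_n)^T=R_k\,(\zeta_1,\dots,\zeta_p)^T\quad\text{and}\quad \mathbf{c}_k=(\mathbf{a}_k\vee\mathbf{b}_k)R_k .$$
   Context: $\mathbf{1}_m=(1,\dots,1)\in\mathbb{R}^m$ (the empty vector if $m=0$), and $\vee$ denotes concatenation of vectors: $(x_1,\dots,x_m)\vee(y_1,\dots,y_n)=(x_1,\dots,x_m,y_1,\dots,y_n)$. A matrix is row stochastic if its entries are nonnegative and every row sums to $1$. The condition $\deg V=r$ means in particular that $V$ is not the zero polynomial. Weighted majorization: for $X\in\mathbb{C}^m$, $Y\in\mathbb{C}^n$ and weight (row) vectors $\mathbf{a}\in[0,1]^m$, $\mathbf{b}\in[0,1]^n$ each with entries summing to $1$, one writes $(X,\mathbf{a})\prec(Y,\mathbf{b})$ if there is a row stochastic $m\times n$ matrix $R$ with $X^T=RY^T$ and $\mathbf{b}=\mathbf{a}R$. *)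

theory Defs
  imports "HOL-Analysis.Analysis" "Jordan_Normal_Form.Matrix"
begin

unbundle no vec_syntax

definition strictly_convex_on :: "'a::real_vector set \<Rightarrow> ('a \<Rightarrow> real) \<Rightarrow> bool" where
  "strictly_convex_on A f \<longleftrightarrow>
     convex A \<and>
     (\<forall>x\<in>A. \<forall>y\<in>A. \<forall>t. x \<noteq> y \<and> 0 < t \<and> t < 1 \<longrightarrow>
        f ((1 - t) *\<^sub>R x + t *\<^sub>R y) < (1 - t) * f x + t * f y)"

definition row_stochastic :: "real mat \<Rightarrow> bool" where
  "row_stochastic R \<longleftrightarrow>
     (\<forall>i<dim_row R. (\<forall>j<dim_col R. 0 \<le> R $$ (i, j)) \<and> (\<Sum>j<dim_col R. R $$ (i, j)) = 1)"

definition weight_vec :: "real Matrix.vec \<Rightarrow> bool" where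
  "weight_vec a \<longleftrightarrow> (\<forall>i<dim_vec a. a $ i \<in> {0..1}) \<and> (\<Sum>i<dim_vec a. a $ i) = 1"

text \<open>The conditions that make \<open>(X, a)\<close> and \<open>(Y, b)\<close> admissible (matching lengths, valid weights)
  are part of the relation, so asserting it also asserts that the weights are valid.\<close>

definition weighted_majorized ::
  "complex Matrix.vec \<times> real Matrix.vec \<Rightarrow> complex Matrix.vec \<times> real Matrix.vec \<Rightarrow> bool"
  (infix \<open>\<prec>\<^sub>w\<close> 50) where
  "Xa \<prec>\<^sub>w Yb \<longleftrightarrow>
     (case (Xa, Yb) of ((X, a), (Y, b)) \<Rightarrow>
        dim_vec a = dim_vec X \<and> dim_vec b = dim_vec Y \<and> weight_vec a \<and> weight_vec b \<and>
        (\<exists>R \<in> carrier_mat (dim_vec X) (dim_vec Y).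
           row_stochastic R \<and>
           X = map_mat complex_of_real R *\<^sub>v Y \<and>
           mat_of_row b = mat_of_row a * R))"

end

theory Submission
  imports Defs "Jordan_Normal_Form.Determinant" "HOL-Computational_Algebra.Fundamental_Theorem_Algebra"
begin

text \<open>Let \<open>T = S\<^sup>(\<^sup>k\<^sup>-\<^sup>1\<^sup>)\<close> have the zeros \<open>w\<^sub>t\<close>. The equation \<open>Q\<^sub>2 T' + Q\<^sub>1 T = - V S\<close> says that the zeros of
  \<open>V\<close> and \<open>S\<close> together are those of \<open>Q\<^sub>2 T \<cdot> (\<Sum> a\<^sub>l / (z - \<zeta>\<^sub>l) + \<Sum> 1 / (z - w\<^sub>t))\<close>, that is, with
  \<open>A\<close> the diagonal matrix of all \<open>\<zeta>\<^sub>l, w\<^sub>t\<close> and \<open>u\<close> the unit vector of the square roots of the normalized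
  weights, the eigenvalues of the compression of \<open>A\<close> to the orthogonal complement of \<open>u\<close>. In a Schur basis
  \<open>e\<^sub>i\<close> of that complement the \<open>i\<close>-th eigenvalue is \<open>\<langle>A e\<^sub>i, e\<^sub>i\<rangle>\<close>, so the matrix of the \<open>\<bar>e\<^sub>i(j)\<bar>\<^sup>2\<close> realizes a
  majorization of \<open>(v, s)\<close> by \<open>(\<zeta>, w)\<close>. The case of equal weights, iterated, yields a majorization of
  \<open>w\<close> by \<open>s\<close>. Composing the two, the zeros \<open>s\<close> occur on both sides and the smaller weight is cancelled.
  Equality for a strictly convex function already in the first step makes every \<open>\<zeta>\<^sub>l\<close> the same point.\<close>

section \<open>Transport plans: composition and cancellation\<close>

text \<open>This is a martingale coupling: the mass \<open>a i\<close> leaving \<open>x i\<close>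
  has \<open>x i\<close> as its barycenter. Masses are not normalized and index sets are arbitrary,
  so that plans can be scaled, placed side by side and reduced; dividing each row by a positive
  \<open>a i\<close> gives a row stochastic matrix.\<close>

definition transport ::
  "('i \<Rightarrow> 'j \<Rightarrow> real) \<Rightarrow> 'i set \<Rightarrow> ('i \<Rightarrow> real) \<Rightarrow> ('i \<Rightarrow> 'v::real_vector) \<Rightarrow>
    'j set \<Rightarrow> ('j \<Rightarrow> real) \<Rightarrow> ('j \<Rightarrow> 'v) \<Rightarrow> bool" where
  "transport M I a x J b y \<longleftrightarrow>
     (\<forall>i\<in>I. \<forall>j\<in>J. 0 \<le> M i j) \<and>
     (\<forall>i\<in>I. (\<Sum>j\<in>J. M i j) = a i) \<and>
     (\<forall>j\<in>J. (\<Sum>i\<in>I. M i j) = b j) \<and>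
     (\<forall>i\<in>I. (\<Sum>j\<in>J. M i j *\<^sub>R y j) = a i *\<^sub>R x i)"

lemma transport_nonneg: "transport M I a x J b y \<Longrightarrow> i \<in> I \<Longrightarrow> j \<in> J \<Longrightarrow> 0 \<le> M i j"
  and transport_row: "transport M I a x J b y \<Longrightarrow> i \<in> I \<Longrightarrow> (\<Sum>j\<in>J. M i j) = a i"
  and transport_col: "transport M I a x J b y \<Longrightarrow> j \<in> J \<Longrightarrow> (\<Sum>i\<in>I. M i j) = b j"
  and transport_mean:
    "transport M I a x J b y \<Longrightarrow> i \<in> I \<Longrightarrow> (\<Sum>j\<in>J. M i j *\<^sub>R y j) = a i *\<^sub>R x i"
  unfolding transport_def by blast+

lemma transport_row_zero:
  assumes "transport M I a x J b y" "finite J" "i \<in> I" "a i = 0" "j \<in> J"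
  shows "M i j = 0"
  using transport_row[OF assms(1,3)] transport_nonneg[OF assms(1,3)] assms(2,4,5)
  by (simp add: sum_nonneg_eq_0_iff)

lemma transport_col_zero:
  assumes "transport M I a x J b y" "finite I" "j \<in> J" "b j = 0" "i \<in> I"
  shows "M i j = 0"
  using transport_col[OF assms(1,3)] transport_nonneg[OF assms(1) _ assms(3)] assms(2,4,5)
  by (simp add: sum_nonneg_eq_0_iff)

lemma transport_cong:
  assumes "transport M I a x J b y"
    and "\<And>i. i \<in> I \<Longrightarrow> a' i = a i" "\<And>i. i \<in> I \<Longrightarrow> x' i = x i"
    and "\<And>j. j \<in> J \<Longrightarrow> b' j = b j" "\<And>j. j \<in> J \<Longrightarrow> y' j = y j"
  shows "transport M I a' x' J b' y'"
  using assms unfolding transport_def by (simp cong: sum.cong)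

lemma transport_refl:
  assumes "finite I" "\<And>i. i \<in> I \<Longrightarrow> 0 \<le> a i"
  shows "transport (\<lambda>i j. if i = j then a i else 0) I a x I a x"
  using assms unfolding transport_def
  by (auto simp: if_distrib[of "\<lambda>c. c *\<^sub>R _"] sum.delta sum.delta' cong: if_cong)

lemma transport_scale:
  assumes "transport M I a x J b y" "0 \<le> d"
  shows "transport (\<lambda>i j. d * M i j) I (\<lambda>i. d * a i) x J (\<lambda>j. d * b j) y"
  using assms unfolding transport_def
  by (simp add: sum_distrib_left[symmetric] scaleR_scaleR[symmetric] scaleR_sum_right[symmetric]
      del: scaleR_scaleR)

text \<open>The mass reaching \<open>j\<close> is passed on in the proportions
  \<open>N j k / b j\<close>. If \<open>b j = 0\<close>, column \<open>j\<close> of \<open>M\<close>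
  and row \<open>j\<close> of \<open>N\<close> vanish, so the value \<open>0\<close> of the quotient
  does no harm.\<close>

lemma transport_trans:
  assumes M: "transport M I a x J b y" and N: "transport N J b y K c z"
    and fin: "finite I" "finite J" "finite K"
  shows "transport (\<lambda>i k. \<Sum>j\<in>J. M i j * N j k / b j) I a x K c z"
  unfolding transport_def
proof (intro conjI ballI)
  have b0: "0 \<le> b j" if "j \<in> J" for j
    using transport_col[OF M that] transport_nonneg[OF M _ that] by (metis sum_nonneg)
  show "0 \<le> (\<Sum>j\<in>J. M i j * N j k / b j)" if "i \<in> I" "k \<in> K" for i k
    using that b0 by (intro sum_nonneg) (simp add: transport_nonneg[OF M] transport_nonneg[OF N])
  have cancel: "M i j / b j * b j = M i j" if "i \<in> I" "j \<in> J" for i j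
    using transport_col_zero[OF M fin(1) that(2) _ that(1)] by (cases "b j = 0") auto
  show "(\<Sum>k\<in>K. \<Sum>j\<in>J. M i j * N j k / b j) = a i" if i: "i \<in> I" for i
  proof -
    have "(\<Sum>k\<in>K. \<Sum>j\<in>J. M i j * N j k / b j) = (\<Sum>j\<in>J. M i j / b j * (\<Sum>k\<in>K. N j k))"
      by (subst sum.swap) (simp add: sum_distrib_left)
    also have "\<dots> = (\<Sum>j\<in>J. M i j)"
      using cancel[OF i] by (intro sum.cong refl) (simp add: transport_row[OF N])
    finally show ?thesis using transport_row[OF M i] by simp
  qed
  show "(\<Sum>i\<in>I. \<Sum>j\<in>J. M i j * N j k / b j) = c k" if k: "k \<in> K" for k
  proof -
    have "(\<Sum>i\<in>I. \<Sum>j\<in>J. M i j * N j k / b j) = (\<Sum>j\<in>J. (\<Sum>i\<in>I. M i j) * N j k / b j)"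
      by (subst sum.swap) (simp add: sum_distrib_right sum_divide_distrib)
    also have "\<dots> = (\<Sum>j\<in>J. N j k)"
      using transport_row_zero[OF N fin(3) _ _ k]
      by (intro sum.cong refl) (auto simp: transport_col[OF M])
    finally show ?thesis using transport_col[OF N k] by simp
  qed
  show "(\<Sum>k\<in>K. (\<Sum>j\<in>J. M i j * N j k / b j) *\<^sub>R z k) = a i *\<^sub>R x i" if i: "i \<in> I" for i
  proof -
    have "(\<Sum>k\<in>K. (\<Sum>j\<in>J. M i j * N j k / b j) *\<^sub>R z k)
        = (\<Sum>j\<in>J. (M i j / b j) *\<^sub>R (\<Sum>k\<in>K. N j k *\<^sub>R z k))"
      by (simp add: scaleR_sum_left scaleR_sum_right) (subst sum.swap, simp)
    also have "\<dots> = (\<Sum>j\<in>J. M i j *\<^sub>R y j)"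
      using cancel[OF i] by (intro sum.cong refl) (simp add: transport_mean[OF N])
    finally show ?thesis using transport_mean[OF M i] by simp
  qed
qed

text \<open>The block diagonal plan. It lets the points \<open>\<zeta> l\<close> stay in place while
  the zeros of the derivative are moved.\<close>

lemma transport_Plus:
  assumes M: "transport M I a x J b y" and N: "transport N I' a' x' J' b' y'"
    and fin: "finite I" "finite J" "finite I'" "finite J'"
  shows "transport (\<lambda>i. case_sum (\<lambda>j. case_sum (\<lambda>i. M i j) (\<lambda>_. 0) i) (\<lambda>j. case_sum (\<lambda>_. 0) (\<lambda>i. N i j) i))
    (I <+> I') (case_sum a a') (case_sum x x') (J <+> J') (case_sum b b') (case_sum y y')"
  using M N fin unfolding transport_def
  by (auto simp: sum.Plus)

text \<open>Mass that would be sent to \<open>t\<close> is passed on to the targets of the source at the same place;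
  this is possible since that source keeps some mass.\<close>

lemma transport_cancel:
  assumes M: "transport M I a x (insert t J) b y"
    and fin: "finite I" "finite J" and "t \<notin> J" "i0 \<in> I" "x i0 = y t" "b t < a i0"
  shows "\<exists>N. transport N I (a(i0 := a i0 - b t)) x J b y"
proof -
  define \<tau> where "\<tau> = M i0 t"
  have nn: "0 \<le> M i j" if "i \<in> I" "j = t \<or> j \<in> J" for i j
    using transport_nonneg[OF M] that by auto
  have row: "(\<Sum>j\<in>J. M i j) = a i - M i t" if "i \<in> I" for i
    using transport_row[OF M that] \<open>t \<notin> J\<close> fin by simp
  have col: "(\<Sum>i\<in>I-{i0}. M i j) = b j - M i0 j" if "j = t \<or> j \<in> J" for j
    using transport_col[OF M] that fin \<open>i0 \<in> I\<close> by (subst sum_diff1) auto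
  have mean: "(\<Sum>j\<in>J. M i j *\<^sub>R y j) = a i *\<^sub>R x i - M i t *\<^sub>R y t" if "i \<in> I" for i
    using transport_mean[OF M that] \<open>t \<notin> J\<close> fin by (simp add: algebra_simps)
  have "\<tau> \<le> b t"
    using col[of t] sum_nonneg[of "I - {i0}" "\<lambda>i. M i t"] nn by (auto simp: \<tau>_def)
  then have \<tau>: "0 < a i0 - \<tau>" using assms(7) by simp
  \<comment> \<open>Without its part sent to \<open>t\<close>, row \<open>i0\<close> has mass
    \<open>a i0 - \<tau>\<close> and still the barycenter \<open>y t\<close>. Its normalization
    therefore replaces the target \<open>t\<close> in every other row, while row \<open>i0\<close>
    is only scaled down to mass \<open>a i0 - b t\<close>.\<close>
  define N where "N i j = (if i = i0 then M i0 j * ((a i0 - b t) / (a i0 - \<tau>))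
      else M i j + M i t / (a i0 - \<tau>) * M i0 j)" for i j
  have mean0: "(\<Sum>j\<in>J. M i0 j *\<^sub>R y j) = (a i0 - \<tau>) *\<^sub>R y t"
    using mean[OF \<open>i0 \<in> I\<close>] assms(6) by (simp add: \<tau>_def algebra_simps)
  have row0: "(\<Sum>j\<in>J. M i0 j) = a i0 - \<tau>"
    using row[OF \<open>i0 \<in> I\<close>] by (simp add: \<tau>_def)
  have "transport N I (a(i0 := a i0 - b t)) x J b y"
    unfolding transport_def
  proof (intro conjI ballI)
    show "0 \<le> N i j" if "i \<in> I" "j \<in> J" for i j
      using that nn \<open>i0 \<in> I\<close> \<tau> assms(7) by (auto simp: N_def)
    show "(\<Sum>j\<in>J. N i j) = (a(i0 := a i0 - b t)) i" if i: "i \<in> I" for i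
    proof (cases "i = i0")
      case True
      then have "(\<Sum>j\<in>J. N i j) = (\<Sum>j\<in>J. M i0 j) * ((a i0 - b t) / (a i0 - \<tau>))"
        unfolding sum_distrib_right using True by (simp add: N_def)
      then show ?thesis using row0 \<tau> True by simp
    next
      case False
      then have "(\<Sum>j\<in>J. N i j) = (\<Sum>j\<in>J. M i j) + M i t / (a i0 - \<tau>) * (\<Sum>j\<in>J. M i0 j)"
        unfolding sum_distrib_left by (simp add: N_def sum.distrib)
      then show ?thesis using row0 row[OF i] \<tau> False by simp
    qed
    show "(\<Sum>i\<in>I. N i j) = b j" if j: "j \<in> J" for j
    proof -
      have "(\<Sum>i\<in>I. N i j) = N i0 j + (\<Sum>i\<in>I-{i0}. N i j)"
        using fin \<open>i0 \<in> I\<close> by (simp add: sum.remove)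
      also have "(\<Sum>i\<in>I-{i0}. N i j) =
          (\<Sum>i\<in>I-{i0}. M i j) + (\<Sum>i\<in>I-{i0}. M i t) / (a i0 - \<tau>) * M i0 j"
        by (simp add: N_def sum.distrib sum_distrib_right sum_divide_distrib)
      also have "N i0 j + \<dots> =
          b j + M i0 j * ((a i0 - b t) / (a i0 - \<tau>) + (b t - \<tau>) / (a i0 - \<tau>) - 1)"
        using j by (simp add: col N_def \<tau>_def[symmetric] algebra_simps)
      also have "(a i0 - b t) / (a i0 - \<tau>) + (b t - \<tau>) / (a i0 - \<tau>) = 1"
        using \<tau> by (simp flip: add_divide_distrib)
      finally have "(\<Sum>i\<in>I. N i j) = b j" by simp
      then show ?thesis .
    qed
    show "(\<Sum>j\<in>J. N i j *\<^sub>R y j) = (a(i0 := a i0 - b t)) i *\<^sub>R x i" if i: "i \<in> I" for i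
    proof (cases "i = i0")
      case True
      have "(\<Sum>j\<in>J. N i j *\<^sub>R y j) = ((a i0 - b t) / (a i0 - \<tau>)) *\<^sub>R (\<Sum>j\<in>J. M i0 j *\<^sub>R y j)"
        unfolding scaleR_sum_right using True by (simp add: N_def mult.commute)
      then show ?thesis using \<tau> True assms(6) unfolding mean0 by simp
    next
      case False
      have "(\<Sum>j\<in>J. N i j *\<^sub>R y j) =
          (\<Sum>j\<in>J. M i j *\<^sub>R y j) + (M i t / (a i0 - \<tau>)) *\<^sub>R (\<Sum>j\<in>J. M i0 j *\<^sub>R y j)"
        unfolding scaleR_sum_right using False
        by (simp add: N_def scaleR_add_left sum.distrib)
      then show ?thesis using \<tau> False unfolding mean0 mean[OF i] by simp
    qed
  qed
  then show ?thesis by blast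
qed

text \<open>Targets are removed one at a time. Injectivity of \<open>\<sigma>\<close> ensures that
  each removal lowers a source on which no remaining target relies.\<close>

lemma transport_cancel_set:
  assumes "finite T" "finite I" "finite J" "T \<inter> J = {}" "inj_on \<sigma> T" "\<sigma> ` T \<subseteq> I"
    and "\<And>t. t \<in> T \<Longrightarrow> x (\<sigma> t) = y t" "\<And>t. t \<in> T \<Longrightarrow> b t = \<beta>" "\<And>t. t \<in> T \<Longrightarrow> \<beta> < a (\<sigma> t)"
    and "transport M I a x (T \<union> J) b y"
  shows "\<exists>N. transport N I (\<lambda>i. if i \<in> \<sigma> ` T then a i - \<beta> else a i) x J b y"
  using assms
proof (induction T arbitrary: a M rule: finite_induct)
  case empty
  then show ?case by auto
next
  case (insert t T)
  have "transport M I a x (insert t (T \<union> J)) b y"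
    using insert.prems by simp
  then obtain N where N: "transport N I (a(\<sigma> t := a (\<sigma> t) - b t)) x (T \<union> J) b y"
    using transport_cancel[of M I a x t "T \<union> J" b y "\<sigma> t"] insert.prems insert.hyps by auto
  have t: "\<sigma> t \<notin> \<sigma> ` T" using insert.prems(4) insert.hyps by auto
  then have ne: "\<sigma> u \<noteq> \<sigma> t" if "u \<in> T" for u using that by (metis imageI)
  have "\<exists>N'. transport N' I (\<lambda>i. if i \<in> \<sigma> ` T then (a(\<sigma> t := a (\<sigma> t) - b t)) i - \<beta>
      else (a(\<sigma> t := a (\<sigma> t) - b t)) i) x J b y"
    using insert.prems ne by (intro insert.IH[OF _ _ _ _ _ _ _ _ N]) auto
  then obtain N' where "transport N' I (\<lambda>i. if i \<in> \<sigma> ` T then (a(\<sigma> t := a (\<sigma> t) - b t)) i - \<beta>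
      else (a(\<sigma> t := a (\<sigma> t) - b t)) i) x J b y" by blast
  from transport_cong[OF this, of _ x b y] t insert.prems(7)[of t] show ?case
    by (intro exI[of _ N']) auto
qed

section \<open>Convex functions along a transport and the case of equality\<close>

text \<open>Jensen's inequality in every row, then summation by columns. The rowwise form is kept
  for the discussion of equality; rows of mass \<open>0\<close> cannot be normalized but
  vanish.\<close>

lemma transport_convex_le:
  assumes M: "transport M I a x J b y" and "finite I" "finite J" and f: "convex_on UNIV f"
  shows "\<And>i. i \<in> I \<Longrightarrow> a i * f (x i) \<le> (\<Sum>j\<in>J. M i j * f (y j))"
    and "(\<Sum>i\<in>I. a i * f (x i)) \<le> (\<Sum>j\<in>J. b j * f (y j))"
proof -
  show row: "a i * f (x i) \<le> (\<Sum>j\<in>J. M i j * f (y j))" if i: "i \<in> I" for i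
  proof (cases "a i = 0")
    case True
    then show ?thesis using transport_row_zero[OF M \<open>finite J\<close> i] by simp
  next
    case False
    have "0 \<le> a i" using transport_row[OF M i] transport_nonneg[OF M i] by (metis sum_nonneg)
    with False have a: "0 < a i" by simp
    have J: "J \<noteq> {}" using False transport_row[OF M i] by auto
    have "x i = (\<Sum>j\<in>J. (M i j / a i) *\<^sub>R y j)"
    proof -
      have "(\<Sum>j\<in>J. (M i j / a i) *\<^sub>R y j) = (1 / a i) *\<^sub>R (\<Sum>j\<in>J. M i j *\<^sub>R y j)"
        unfolding scaleR_sum_right by simp
      then show ?thesis using a transport_mean[OF M i] by simp
    qed
    then have "f (x i) \<le> (\<Sum>j\<in>J. M i j / a i * f (y j))"
      using convex_on_sum[OF \<open>finite J\<close> J f, of "\<lambda>j. M i j / a i" y] a transport_nonneg[OF M i]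
        transport_row[OF M i] by (simp flip: sum_divide_distrib)
    then have "a i * f (x i) \<le> a i * (\<Sum>j\<in>J. M i j / a i * f (y j))" using a by simp
    also have "\<dots> = (\<Sum>j\<in>J. M i j * f (y j))" using a by (simp add: sum_distrib_left)
    finally show ?thesis .
  qed
  have "(\<Sum>i\<in>I. a i * f (x i)) \<le> (\<Sum>i\<in>I. \<Sum>j\<in>J. M i j * f (y j))"
    using row by (rule sum_mono)
  also have "\<dots> = (\<Sum>j\<in>J. b j * f (y j))"
    by (subst sum.swap) (simp add: transport_col[OF M] flip: sum_distrib_right)
  finally show "(\<Sum>i\<in>I. a i * f (x i)) \<le> (\<Sum>j\<in>J. b j * f (y j))" .
qed

lemma strictly_convex_on_imp_convex_on:
  assumes "strictly_convex_on A f" shows "convex_on A f"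
proof (rule convex_onI)
  show "convex A" using assms by (simp add: strictly_convex_on_def)
  show "f ((1 - t) *\<^sub>R x + t *\<^sub>R y) \<le> (1 - t) * f x + t * f y"
    if "0 < t" "t < 1" "x \<in> A" "y \<in> A" for t x y
  proof (cases "x = y")
    case True
    then show ?thesis by (simp add: algebra_simps flip: scaleR_add_left)
  next
    case False
    then show ?thesis using assms that by (auto simp: strictly_convex_on_def intro: less_imp_le)
  qed
qed

text \<open>Write \<open>x\<close> as a mean of \<open>y k\<close> and the barycenter
  \<open>w\<close> of the other points. If \<open>y k\<close> were not \<open>x\<close>, then
  \<open>w\<close> and \<open>y k\<close> would differ, and strict convexity on this segment with
  Jensen for \<open>w\<close> would make the inequality strict.\<close>

lemma strictly_convex_mean_eq:
  fixes x :: "'v::real_vector"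
  assumes f: "strictly_convex_on UNIV f" and J: "finite J" "\<And>j. j \<in> J \<Longrightarrow> 0 \<le> t j" "sum t J = 1"
    and x: "x = (\<Sum>j\<in>J. t j *\<^sub>R y j)" and eq: "f x = (\<Sum>j\<in>J. t j * f (y j))"
    and k: "k \<in> J" "0 < t k"
  shows "y k = x"
proof (rule ccontr)
  assume ne: "y k \<noteq> x"
  define J' where "J' = J - {k}"
  have sJ': "sum t J' = 1 - t k"
    using J k by (simp add: J'_def sum_diff1)
  have xs: "x = t k *\<^sub>R y k + (\<Sum>j\<in>J'. t j *\<^sub>R y j)"
    unfolding x J'_def using J k by (simp add: sum.remove)
  have fs: "f x = t k * f (y k) + (\<Sum>j\<in>J'. t j * f (y j))"
    unfolding eq J'_def using J k by (simp add: sum.remove)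
  have "t k \<le> 1" using sJ' sum_nonneg[of J' t] J by (auto simp: J'_def)
  moreover have "t k \<noteq> 1"
  proof
    assume 1: "t k = 1"
    then have "t j = 0" if "j \<in> J'" for j
      using sJ' J that sum_nonneg_eq_0_iff[of J' t] by (auto simp: J'_def)
    then show False using ne xs 1 by simp
  qed
  ultimately have lt: "t k < 1" by simp
  define w where "w = (\<Sum>j\<in>J'. (t j / (1 - t k)) *\<^sub>R y j)"
  have w: "(1 - t k) *\<^sub>R w = (\<Sum>j\<in>J'. t j *\<^sub>R y j)"
    using lt by (simp add: w_def scaleR_sum_right)
  have "w \<noteq> y k"
  proof
    assume "w = y k"
    then have "x = t k *\<^sub>R y k + (1 - t k) *\<^sub>R y k" using xs w by simp
    then show False using ne by (simp flip: scaleR_add_left)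
  qed
  then have "f ((1 - t k) *\<^sub>R w + t k *\<^sub>R y k) < (1 - t k) * f w + t k * f (y k)"
    using f k lt unfolding strictly_convex_on_def by blast
  moreover have "f w \<le> (\<Sum>j\<in>J'. t j / (1 - t k) * f (y j))"
  proof -
    have "J' \<noteq> {}" using sJ' lt by auto
    then show ?thesis
      unfolding w_def using lt J sJ'
      by (intro convex_on_sum[OF _ _ strictly_convex_on_imp_convex_on[OF f]])
        (auto simp: J'_def simp flip: sum_divide_distrib)
  qed
  then have "(1 - t k) * f w \<le> (1 - t k) * (\<Sum>j\<in>J'. t j / (1 - t k) * f (y j))"
    using lt by (intro mult_left_mono) auto
  then have "(1 - t k) * f w \<le> (\<Sum>j\<in>J'. t j * f (y j))"
    using lt by (simp add: sum_distrib_left)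
  ultimately show False using fs xs w by (simp add: add.commute)
qed

text \<open>Equality of the totals forces equality in each row, and there the equality case of
  Jensen's inequality applies.\<close>

lemma transport_strictly_convex_eq:
  assumes M: "transport M I (\<lambda>_. 1) x J b y" and fin: "finite I" "finite J"
    and f: "strictly_convex_on UNIV f" and eq: "(\<Sum>i\<in>I. f (x i)) = (\<Sum>j\<in>J. b j * f (y j))"
    and ij: "i \<in> I" "j \<in> J" "0 < M i j"
  shows "y j = x i"
proof (rule strictly_convex_mean_eq[OF f fin(2), of "M i"])
  have c: "convex_on UNIV f" by (rule strictly_convex_on_imp_convex_on[OF f])
  have "(\<Sum>i\<in>I. f (x i)) = (\<Sum>i\<in>I. \<Sum>j\<in>J. M i j * f (y j))"
    unfolding eq by (subst sum.swap) (simp add: transport_col[OF M] flip: sum_distrib_right)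
  then show "f (x i) = (\<Sum>j\<in>J. M i j * f (y j))"
    using sum_mono_inv[of "\<lambda>i. f (x i)" I "\<lambda>i. \<Sum>j\<in>J. M i j * f (y j)" i]
      transport_convex_le(1)[OF M fin c] fin ij by simp
qed (use M ij in \<open>auto simp: transport_nonneg transport_row transport_mean\<close>)

text \<open>The sources located at \<open>y k\<close> receive all of the mass in the class of \<open>k\<close>, so that the total
  mass of that class is an integer, which forces the class to be everything.\<close>

lemma transport_strictly_convex_eq_const:
  assumes M: "transport M I (\<lambda>_. 1) x J (\<lambda>j. 1 - \<gamma> j) y" and fin: "finite I" "finite J"
    and f: "strictly_convex_on UNIV f"
    and eq: "(\<Sum>i\<in>I. f (x i)) = (\<Sum>j\<in>J. (1 - \<gamma> j) * f (y j))"
    and \<gamma>: "\<And>j. j \<in> J \<Longrightarrow> 0 < \<gamma> j" "sum \<gamma> J = 1" and k: "k \<in> J" and j: "j \<in> J"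
  shows "y j = y k"
proof (rule ccontr)
  assume ne: "y j \<noteq> y k"
  define C where "C = {j\<in>J. y j = y k}"
  define L where "L = {i\<in>I. x i = y k}"
  have C: "C \<subseteq> J" "finite C" and L: "L \<subseteq> I" "finite L" using fin by (auto simp: C_def L_def)
  have zero: "M i j = 0" if "i \<in> I" "j \<in> J" "y j \<noteq> x i" for i j
    using transport_strictly_convex_eq[OF M fin f eq that(1,2)] transport_nonneg[OF M that(1,2)] that(3)
    by fastforce
  have "(\<Sum>j\<in>C. 1 - \<gamma> j) = (\<Sum>j\<in>C. \<Sum>i\<in>I. M i j)"
    using C by (intro sum.cong) (auto simp: transport_col[OF M])
  also have "\<dots> = (\<Sum>i\<in>I. \<Sum>j\<in>C. M i j)" by (rule sum.swap)
  also have "\<dots> = (\<Sum>i\<in>L. \<Sum>j\<in>C. M i j)"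
  proof (intro sum.mono_neutral_right ballI sum.neutral)
    show "M i j = 0" if "i \<in> I - L" "j \<in> C" for i j
      using zero[of i j] that by (auto simp: L_def C_def)
  qed (use fin L in auto)
  also have "\<dots> = (\<Sum>i\<in>L. \<Sum>j\<in>J. M i j)"
    using fin C zero by (intro sum.cong refl sum.mono_neutral_left) (auto simp: L_def C_def)
  also have "\<dots> = (\<Sum>i\<in>L. 1)"
    using L by (intro sum.cong) (auto simp: transport_row[OF M])
  \<comment> \<open>Columns in \<open>C\<close> meet only rows in \<open>L\<close> and conversely,
    so both carry the same mass. Hence \<open>sum \<gamma> C\<close> is an integer, although it lies
    strictly between \<open>0\<close> and \<open>1\<close> as long as \<open>j\<close> is outside
    \<open>C\<close>.\<close>
  finally have "of_int (int (card C) - int (card L)) = sum \<gamma> C"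
    by (simp add: sum_subtractf)
  moreover have "0 < sum \<gamma> C"
    using C \<gamma> k by (intro sum_pos) (auto simp: C_def)
  moreover have "sum \<gamma> C < sum \<gamma> J"
  proof -
    have "sum \<gamma> J = sum \<gamma> C + sum \<gamma> (J - C)"
      using C fin by (simp add: sum.subset_diff)
    moreover have "0 < sum \<gamma> (J - C)"
      using fin \<gamma> j ne by (intro sum_pos) (auto simp: C_def)
    ultimately show ?thesis by simp
  qed
  ultimately have "(0::real) < of_int (int (card C) - int (card L))"
      "of_int (int (card C) - int (card L)) < (1::real)"
    using \<gamma>(2) by simp_all
  then show False unfolding of_int_0_less_iff of_int_less_1_iff by linarith
qed

section \<open>Orthogonal projection and unitarity in coordinates\<close>

definition cinner :: "nat \<Rightarrow> (nat \<Rightarrow> complex) \<Rightarrow> (nat \<Rightarrow> complex) \<Rightarrow> complex" where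
  "cinner N x z = (\<Sum>j<N. x j * cnj (z j))"

lemma cinner_add: "cinner N (\<lambda>j. x j + y j) z = cinner N x z + cinner N y z"
  and cinner_scale: "cinner N (\<lambda>j. c * x j) z = c * cinner N x z"
  and cinner_sum: "cinner N (\<lambda>j. \<Sum>k\<in>K. h k j) z = (\<Sum>k\<in>K. cinner N (h k) z)"
  unfolding cinner_def
  by (simp_all add: sum.distrib sum_distrib_left sum_distrib_right algebra_simps)
    (rule sum.swap)

lemma cinner_commute: "cinner N z x = cnj (cinner N x z)"
  by (simp add: cinner_def mult.commute)

lemma cinner_self: "cinner N x x = of_real (\<Sum>j<N. (cmod (x j))\<^sup>2)"
  by (simp add: cinner_def flip: complex_norm_square)

lemma cinner_self_eq_0: "cinner N x x = 0 \<longleftrightarrow> (\<forall>j<N. x j = 0)"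
  unfolding cinner_self of_real_eq_0_iff by (auto simp: sum_nonneg_eq_0_iff)

text \<open>Gram-Schmidt, one vector at a time, for a family that may be linearly dependent: project
  \<open>x\<close> and \<open>h m\<close> off the earlier vectors, then remove from the first result
  \<open>X\<close> its component along the second one \<open>H\<close>.\<close>

lemma orthogonal_projection_exists:
  assumes "finite K"
  shows "\<exists>c. \<forall>k\<in>K. cinner N (\<lambda>j. x j + (\<Sum>l\<in>K. c l * h l j)) (h k) = 0"
  using assms
proof (induction K arbitrary: x rule: finite_induct)
  case empty
  then show ?case by simp
next
  case (insert m K)
  obtain c where c: "\<forall>k\<in>K. cinner N (\<lambda>j. x j + (\<Sum>l\<in>K. c l * h l j)) (h k) = 0"
    using insert.IH by blast
  obtain d where d: "\<forall>k\<in>K. cinner N (\<lambda>j. h m j + (\<Sum>l\<in>K. d l * h l j)) (h k) = 0"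
    using insert.IH by blast
  define X where "X j = x j + (\<Sum>l\<in>K. c l * h l j)" for j
  define H where "H j = h m j + (\<Sum>l\<in>K. d l * h l j)" for j
  \<comment> \<open>If \<open>H\<close> vanishes below \<open>N\<close>, this is \<open>0\<close> by
    the convention for division, and orthogonality to \<open>H\<close> is trivial.\<close>
  define \<mu> where "\<mu> = - (cinner N X H / cinner N H H)"
  define e where "e l = (if l = m then \<mu> else c l + \<mu> * d l)" for l
  have XH: "x j + (\<Sum>l\<in>insert m K. e l * h l j) = X j + \<mu> * H j" for j
  proof -
    have "(\<Sum>l\<in>K. e l * h l j) = (\<Sum>l\<in>K. c l * h l j + \<mu> * (d l * h l j))"
      using insert.hyps by (intro sum.cong) (auto simp: e_def algebra_simps)
    then show ?thesis
      using insert.hyps by (simp add: X_def H_def e_def sum.distrib sum_distrib_left algebra_simps)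
  qed
  have K: "cinner N (\<lambda>j. X j + \<mu> * H j) (h k) = 0" if "k \<in> K" for k
    using c d that by (simp add: cinner_add cinner_scale X_def[abs_def] H_def[abs_def])
  have "cinner N (\<lambda>j. X j + \<mu> * H j) H = 0"
  proof (cases "cinner N H H = 0")
    case True
    then have "\<forall>j<N. H j = 0" by (simp add: cinner_self_eq_0)
    then show ?thesis by (simp add: cinner_def)
  next
    case False
    then show ?thesis unfolding cinner_add cinner_scale by (simp add: \<mu>_def)
  qed
  moreover have "cinner N (\<lambda>j. X j + \<mu> * H j) H = cinner N (\<lambda>j. X j + \<mu> * H j) (h m)"
  proof -
    have "cinner N H z = cinner N (h m) z" if "\<forall>k\<in>K. cinner N z (h k) = 0" for z
    proof -
      have "cinner N (h k) z = 0" if "k \<in> K" for k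
        using \<open>\<forall>k\<in>K. cinner N z (h k) = 0\<close> that cinner_commute[of N "h k" z] by simp
      then show ?thesis by (simp add: H_def[abs_def] cinner_add cinner_sum cinner_scale)
    qed
    then show ?thesis
      using K cinner_commute[of N _ "\<lambda>j. X j + \<mu> * H j"] by (metis complex_cnj_cnj)
  qed
  ultimately show ?case
    using K by (intro exI[of _ e]) (auto simp: XH)
qed

text \<open>A right inverse of a square matrix is also a left inverse, so orthonormal rows give
  columns of norm one.\<close>

lemma orthonormal_column_sum:
  assumes "\<And>i k. i < N \<Longrightarrow> k < N \<Longrightarrow> cinner N (e i) (e k) = (if i = k then 1 else 0)" and "j < N"
  shows "(\<Sum>i<N. (cmod (e i j))\<^sup>2) = 1"
proof -
  define A where "A = Matrix.mat N N (\<lambda>(i, j). e i j)"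
  define B where "B = Matrix.mat N N (\<lambda>(j, i). cnj (e i j))"
  have "A * B = 1\<^sub>m N"
    using assms(1)
    by (intro eq_matI) (auto simp: A_def B_def scalar_prod_def cinner_def atLeast0LessThan)
  then have "B * A = 1\<^sub>m N"
    by (intro mat_mult_left_right_inverse[of A N B]) (auto simp: A_def B_def)
  then have "(B * A) $$ (j, j) = 1" using assms(2) by simp
  moreover have "(B * A) $$ (j, j) = (\<Sum>i<N. cnj (e i j) * e i j)"
    using assms(2) by (simp add: A_def B_def scalar_prod_def atLeast0LessThan)
  ultimately have "(\<Sum>i<N. e i j * cnj (e i j)) = 1"
    by (simp add: mult.commute)
  then have "complex_of_real (\<Sum>i<N. (cmod (e i j))\<^sup>2) = 1"
    by (simp flip: complex_norm_square)
  then show ?thesis using of_real_eq_1_iff by blast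
qed

section \<open>Zeros of a positive combination of cofactors\<close>

lemma degree_linear_prod: "degree (\<Prod>i\<in>A. [:- z i, 1:]) = card A" for z :: "'a \<Rightarrow> complex"
  by (subst degree_prod_eq_sum_degree) auto

lemma monic_linear_prod: "lead_coeff (\<Prod>i\<in>A. [:- z i, 1:]) = 1" for z :: "'a \<Rightarrow> complex"
  by (simp add: lead_coeff_prod)

lemma poly_linear_prod: "poly (\<Prod>i\<in>A. [:- z i, 1:]) w = (\<Prod>i\<in>A. w - z i)" for z :: "'a \<Rightarrow> complex"
  by (simp add: poly_prod)

text \<open>The sum is the leading coefficient of the Lagrange interpolation polynomial of \<open>G\<close>.\<close>

lemma sum_divided_difference_eq_0:
  fixes y :: "'j \<Rightarrow> complex"
  assumes "finite J" "inj_on y J" "Suc (degree G) < card J"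
  shows "(\<Sum>j\<in>J. poly G (y j) / (\<Prod>l\<in>J-{j}. y j - y l)) = 0"
proof -
  define c where "c j = poly G (y j) / (\<Prod>l\<in>J-{j}. y j - y l)" for j
  define P where "P j = (\<Prod>l\<in>J-{j}. [:- y l, 1:])" for j
  define H where "H = (\<Sum>j\<in>J. Polynomial.smult (c j) (P j))"
  have deg: "degree (P j) = card J - 1" if "j \<in> J" for j
    using that assms(1) by (simp add: P_def degree_linear_prod)
  have "H = G"
  proof (rule poly_eqI_degree[of "y ` J"])
    have "degree H \<le> card J - 1"
      unfolding H_def using deg by (intro degree_sum_le assms(1)) (auto intro: degree_smult_le order_trans)
    then show "degree H < card (y ` J)" "degree G < card (y ` J)"
      using assms by (auto simp: card_image)
    show "poly H w = poly G w" if "w \<in> y ` J" for w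
    proof -
      from that obtain k where k: "k \<in> J" "w = y k" by blast
      have "poly H w = (\<Sum>j\<in>J. c j * (\<Prod>l\<in>J-{j}. y k - y l))"
        by (simp add: H_def P_def poly_sum poly_linear_prod k)
      also have "\<dots> = c k * (\<Prod>l\<in>J-{k}. y k - y l)"
        using k assms(1) by (subst sum.remove[of J k]) (auto intro!: sum.neutral prod_zero)
      also have "\<dots> = poly G w"
        using assms(1,2) k by (auto simp: c_def inj_on_def)
      finally show ?thesis .
    qed
  qed
  then have "coeff H (card J - 1) = 0" using assms(3) by (simp add: coeff_eq_0)
  moreover have "coeff (P j) (card J - 1) = 1" if "j \<in> J" for j
    using deg[OF that] monic_linear_prod[of y "J - {j}"] by (simp add: P_def)
  ultimately show ?thesis
    by (simp add: H_def coeff_sum c_def)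
qed

text \<open>The resolvent vectors \<open>h i = (A - x\<^sub>i)\<^sup>-\<^sup>1 \<dots> (A - x\<^sub>1)\<^sup>-\<^sup>1 u\<close> span the invariant flag of the
  compression of \<open>A\<close> to the orthogonal complement of \<open>u = h 0\<close>; \<open>q i\<close> is the Schur basis obtained
  from them by Gram--Schmidt.\<close>

lemma transport_of_distinct_nodes:
  fixes y x :: "nat \<Rightarrow> complex"
  assumes inj: "inj_on y {..<N}"
    and \<gamma>: "\<And>j. j < N \<Longrightarrow> 0 < \<gamma> j" "(\<Sum>j<N. \<gamma> j) = 1"
    and F: "(\<Prod>i\<in>{1..<N}. [:- x i, 1:]) =
      (\<Sum>j<N. Polynomial.smult (of_real (\<gamma> j)) (\<Prod>l\<in>{..<N}-{j}. [:- y l, 1:]))"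
  shows "\<exists>R. transport R {1..<N} (\<lambda>_. 1) x {..<N} (\<lambda>j. 1 - \<gamma> j) y"
proof -
  have Fy: "(\<Prod>i\<in>{1..<N}. y j - x i) = of_real (\<gamma> j) * (\<Prod>l\<in>{..<N}-{j}. y j - y l)" if "j < N" for j
  proof -
    have "(\<Prod>i\<in>{1..<N}. y j - x i) =
        (\<Sum>k<N. of_real (\<gamma> k) * (\<Prod>l\<in>{..<N}-{k}. y j - y l))"
      using arg_cong[OF F, of "\<lambda>p. poly p (y j)"] by (simp add: poly_linear_prod poly_sum)
    also have "\<dots> = of_real (\<gamma> j) * (\<Prod>l\<in>{..<N}-{j}. y j - y l)"
      using that by (subst sum.remove[of _ j]) (auto intro!: sum.neutral prod_zero)
    finally show ?thesis .
  qed
  have dy: "(\<Prod>l\<in>{..<N}-{j}. y j - y l) \<noteq> 0" if "j < N" for j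
    using inj that by (auto simp: inj_on_def)
  have ne: "y j \<noteq> x i" if "j < N" "i \<in> {1..<N}" for i j
  proof
    assume "y j = x i"
    then have "(\<Prod>i\<in>{1..<N}. y j - x i) = 0" using that by (intro prod_zero) auto
    moreover have "of_real (\<gamma> j) * (\<Prod>l\<in>{..<N}-{j}. y j - y l) \<noteq> 0"
      using dy[OF that(1)] \<gamma>(1)[OF that(1)] unfolding mult_eq_0_iff of_real_eq_0_iff by simp
    ultimately show False using Fy[OF that(1)] by metis
  qed
  define \<pi> where "\<pi> i j = (\<Prod>t\<in>{1..i}. y j - x t)" for i j
  have \<pi>: "\<pi> i j \<noteq> 0" if "j < N" "i < N" for i j
    using ne that by (auto simp: \<pi>_def)
  define h where "h i j = of_real (sqrt (\<gamma> j)) / \<pi> i j" for i j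
  have step: "(y j - x i) * h i j = h (i - 1) j" if "j < N" "i \<in> {1..<N}" for i j
  proof -
    have "\<pi> i j = \<pi> (i - 1) j * (y j - x i)"
      using that by (cases i) (auto simp: \<pi>_def)
    then show ?thesis using ne[OF that] \<pi>[OF that(1), of "i - 1"] that by (simp add: h_def)
  qed
  \<comment> \<open>By \<open>Fy\<close>, dividing \<open>\<gamma> j\<close> by the first
    \<open>i\<close> factors leaves the remaining factors \<open>G\<close> at \<open>y j\<close>
    over the node differences. As \<open>G\<close> has degree \<open>N - 1 - i\<close>, below
    \<open>N - 1\<close>, the divided difference vanishes.\<close>
  have h0: "cinner N (h i) (h 0) = 0" if i: "i \<in> {1..<N}" for i
  proof -
    define G where "G = (\<Prod>t\<in>{i<..<N}. [:- x t, 1:])"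
    have "h i j * cnj (h 0 j) = poly G (y j) / (\<Prod>l\<in>{..<N}-{j}. y j - y l)" if j: "j < N" for j
    proof -
      have "{1..<N} = {1..i} \<union> {i<..<N}" using i by auto
      then have "\<pi> i j * poly G (y j) = (\<Prod>i\<in>{1..<N}. y j - x i)"
        unfolding \<open>{1..<N} = _\<close>
        by (simp add: \<pi>_def G_def poly_linear_prod prod.union_disjoint disjoint_iff)
      also note Fy[OF j]
      finally have "of_real (\<gamma> j) / \<pi> i j = poly G (y j) / (\<Prod>l\<in>{..<N}-{j}. y j - y l)"
        using \<pi>[OF j, of i] dy[OF j] i by (simp add: field_simps)
      moreover have "complex_of_real (sqrt (\<gamma> j)) * of_real (sqrt (\<gamma> j)) = of_real (\<gamma> j)"
        using \<gamma>(1)[OF j] by (simp flip: of_real_mult)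
      then have "h i j * cnj (h 0 j) = of_real (\<gamma> j) / \<pi> i j"
        by (simp add: h_def \<pi>_def[of 0])
      ultimately show ?thesis by simp
    qed
    then have "cinner N (h i) (h 0) = (\<Sum>j<N. poly G (y j) / (\<Prod>l\<in>{..<N}-{j}. y j - y l))"
      unfolding cinner_def by (intro sum.cong) auto
    also have "\<dots> = 0"
      using i by (intro sum_divided_difference_eq_0 inj) (auto simp: G_def degree_linear_prod)
    finally show ?thesis .
  qed
  \<comment> \<open>Index \<open>0\<close> is left out of the projection because \<open>h0\<close>
    already makes \<open>h 0\<close> orthogonal to all the other vectors.\<close>
  have "\<forall>i. \<exists>c. \<forall>k\<in>{1..<i}. cinner N (\<lambda>j. h i j + (\<Sum>l\<in>{1..<i}. c l * h l j)) (h k) = 0"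
    by (intro allI orthogonal_projection_exists) simp
  then obtain c where
    c: "\<And>i k. k \<in> {1..<i} \<Longrightarrow> cinner N (\<lambda>j. h i j + (\<Sum>l\<in>{1..<i}. c i l * h l j)) (h k) = 0"
    by metis
  define q where "q i j = h i j + (\<Sum>l\<in>{1..<i}. c i l * h l j)" for i j
  have q0: "q 0 = h 0" by (simp add: q_def fun_eq_iff)
  have qh: "cinner N (q i) (h k) = 0" if "i < N" "k < i" for i k
  proof (cases "k = 0")
    case True
    then show ?thesis
      using that h0 by (simp add: q_def[abs_def] cinner_add cinner_sum cinner_scale)
  next
    case False
    then show ?thesis using c[of k i] that by (simp add: q_def[abs_def])
  qed
  have hq: "cinner N (h k) (q i) = 0" if "i < N" "k < i" for i k
    using qh[OF that] cinner_commute[of N "h k" "q i"] by simp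
  have qq_less: "cinner N (q k) (q i) = 0" if "i < N" "k < i" for i k
  proof -
    have "cinner N (q k) (q i) = cinner N (h k) (q i) + (\<Sum>l\<in>{1..<k}. c k l * cinner N (h l) (q i))"
      by (subst q_def[abs_def]) (simp add: cinner_add cinner_sum cinner_scale)
    then show ?thesis using hq[OF that(1)] that by simp
  qed
  have qq: "cinner N (q i) (q k) = 0" if "i < N" "k < N" "i \<noteq> k" for i k
    using qq_less[of i k] qq_less[of k i] cinner_commute[of N "q i" "q k"] that
    by (cases "i < k") auto
  \<comment> \<open>Since \<open>A\<close> maps \<open>h l\<close> to
    \<open>h (l - 1) + x l * h l\<close>, applying \<open>A - x i\<close> to \<open>q i\<close>
    gives a combination of \<open>h 0\<close>, ..., \<open>h (i - 1)\<close>, and these are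
    orthogonal to \<open>q i\<close>. So \<open>x i\<close> is the Rayleigh quotient of
    \<open>q i\<close>.\<close>
  have Aq: "cinner N (\<lambda>j. (y j - x i) * q i j) (q i) = 0" if i: "i \<in> {1..<N}" for i
  proof -
    have "(y j - x i) * q i j = h (i - 1) j +
        (\<Sum>l\<in>{1..<i}. c i l * (h (l - 1) j + (x l - x i) * h l j))" if j: "j < N" for j
    proof -
      have "(y j - x i) * (c i l * h l j) = c i l * (h (l - 1) j + (x l - x i) * h l j)"
        if "l \<in> {1..<i}" for l
      proof -
        have "h (l - 1) j = (y j - x l) * h l j"
          using step[OF j, of l] that i by simp
        then show ?thesis by (simp add: algebra_simps)
      qed
      then show ?thesis
        using step[OF j i] by (simp add: q_def distrib_left sum_distrib_left)
    qed
    then have "cinner N (\<lambda>j. (y j - x i) * q i j) (q i) =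
        cinner N (\<lambda>j. h (i - 1) j + (\<Sum>l\<in>{1..<i}. c i l * (h (l - 1) j + (x l - x i) * h l j))) (q i)"
      unfolding cinner_def by (intro sum.cong) auto
    also have "\<dots> = 0"
      using i hq[of i] by (auto simp: cinner_add cinner_sum cinner_scale intro!: sum.neutral)
    finally show ?thesis .
  qed
  define \<nu> where "\<nu> i = (\<Sum>j<N. (cmod (q i j))\<^sup>2)" for i
  have \<nu>0: "\<nu> 0 = 1"
    using \<gamma> by (simp add: \<nu>_def q0 h_def \<pi>_def less_imp_le cong: sum.cong_simp)
  have N: "0 < N" using \<gamma>(2) by (cases N) auto
  have \<nu>: "0 < \<nu> i" if i: "i < N" for i
  proof (cases "i = 0")
    case False
    have "\<nu> i \<noteq> 0"
    proof
      assume "\<nu> i = 0"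
      then have q_zero: "q i j = 0" if "j < N" for j
        using that by (simp add: \<nu>_def sum_nonneg_eq_0_iff)
      \<comment> \<open>Clearing the denominators \<open>\<pi> i j\<close> in \<open>q i = 0\<close>
        makes all \<open>N\<close> nodes zeros of this polynomial of degree below \<open>N\<close>.
        So it would be zero, but its value at \<open>x i\<close> is \<open>1\<close>, since each
        product contains the factor for \<open>t = i\<close>.\<close>
      define P where "P = 1 + (\<Sum>k\<in>{1..<i}. Polynomial.smult (c i k) (\<Prod>t\<in>{k<..i}. [:- x t, 1:]))"
      have "poly P (y j) = 0" if j: "j < N" for j
      proof -
        have ratio: "\<pi> i j / \<pi> k j = (\<Prod>t\<in>{k<..i}. y j - x t)" if "k \<in> {1..<i}" for k
        proof -
          have "{1..i} = {1..k} \<union> {k<..i}" using that by auto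
          then have "\<pi> i j = \<pi> k j * (\<Prod>t\<in>{k<..i}. y j - x t)"
            unfolding \<pi>_def by (simp add: prod.union_disjoint disjoint_iff)
          then show ?thesis using \<pi>[OF j, of k] that i by simp
        qed
        have "\<pi> i j * (c i k * h k j) = of_real (sqrt (\<gamma> j)) * (c i k * (\<Prod>t\<in>{k<..i}. y j - x t))"
          if "k \<in> {1..<i}" for k
          unfolding ratio[OF that, symmetric] h_def by (simp add: mult_ac)
        then have "\<pi> i j * q i j = \<pi> i j * h i j +
            (\<Sum>k\<in>{1..<i}. of_real (sqrt (\<gamma> j)) * (c i k * (\<Prod>t\<in>{k<..i}. y j - x t)))"
          unfolding q_def distrib_left sum_distrib_left by (intro arg_cong2[where f="(+)"] sum.cong refl)
        also have "\<dots> = of_real (sqrt (\<gamma> j)) * poly P (y j)"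
          using \<pi>[OF j i]
          by (simp add: P_def h_def poly_sum poly_linear_prod distrib_left sum_distrib_left)
        finally have "of_real (sqrt (\<gamma> j)) * poly P (y j) = \<pi> i j * q i j" ..
        then show ?thesis using q_zero[OF j] \<gamma>(1)[OF j] by simp
      qed
      moreover have "degree P < N"
      proof -
        have "degree P \<le> i - 1"
          unfolding P_def
          by (intro degree_add_le degree_sum_le order_trans[OF degree_smult_le])
            (auto simp: degree_linear_prod)
        then show ?thesis using i by simp
      qed
      ultimately have "P = 0"
        using N inj by (intro poly_eqI_degree[of "y ` {..<N}"]) (auto simp: card_image)
      moreover have "poly P (x i) = 1"
      proof -
        have "(\<Prod>t\<in>{k<..i}. x i - x t) = 0" if "k \<in> {1..<i}" for k
          using that by (intro prod_zero) auto
        then have "(\<Sum>k\<in>{1..<i}. c i k * (\<Prod>t\<in>{k<..i}. x i - x t)) = 0"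
          by (intro sum.neutral ballI) (simp only: mult_zero_right)
        then show ?thesis by (simp add: P_def poly_sum poly_linear_prod)
      qed
      ultimately show False by simp
    qed
    moreover have "0 \<le> \<nu> i" by (simp add: \<nu>_def sum_nonneg)
    ultimately show ?thesis by simp
  qed (simp add: \<nu>0)
  \<comment> \<open>Squared coordinates of an orthonormal basis are doubly stochastic. Row
    \<open>0\<close> belongs to \<open>u\<close> and equals \<open>\<gamma>\<close>; dropping it
    leaves the column sums \<open>1 - \<gamma> j\<close>.\<close>
  define R where "R i j = (cmod (q i j))\<^sup>2 / \<nu> i" for i j
  have col: "(\<Sum>i<N. R i j) = 1" if "j < N" for j
  proof -
    have "(\<Sum>i<N. (cmod (q i j / of_real (sqrt (\<nu> i))))\<^sup>2) = 1"
    proof (rule orthonormal_column_sum[OF _ that])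
      fix i k assume ik: "i < N" "k < N"
      have "cinner N (\<lambda>j. q i j / of_real (sqrt (\<nu> i))) (\<lambda>j. q k j / of_real (sqrt (\<nu> k))) =
          cinner N (q i) (q k) / of_real (sqrt (\<nu> i) * sqrt (\<nu> k))"
        by (simp add: cinner_def sum_divide_distrib)
      also have "\<dots> = (if i = k then 1 else 0)"
        using qq[OF ik] \<nu>[OF ik(1)] by (cases "i = k") (simp_all add: cinner_self \<nu>_def[symmetric] flip: of_real_mult)
      finally show "cinner N (\<lambda>j. q i j / of_real (sqrt (\<nu> i))) (\<lambda>j. q k j / of_real (sqrt (\<nu> k))) =
          (if i = k then 1 else 0)" .
    qed
    moreover have "(cmod (q i j / of_real (sqrt (\<nu> i))))\<^sup>2 = R i j" if "i < N" for i
      using \<nu>[OF that] by (simp add: R_def norm_divide power_divide)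
    ultimately show ?thesis by simp
  qed
  have "transport R {1..<N} (\<lambda>_. 1) x {..<N} (\<lambda>j. 1 - \<gamma> j) y"
    unfolding transport_def
  proof (intro conjI ballI)
    show "0 \<le> R i j" if "i \<in> {1..<N}" for i j
      using \<nu>[of i] that by (simp add: R_def)
    show row: "(\<Sum>j<N. R i j) = 1" if "i \<in> {1..<N}" for i
      using \<nu>[of i] that by (simp add: R_def \<nu>_def[symmetric] flip: sum_divide_distrib)
    show "(\<Sum>i\<in>{1..<N}. R i j) = 1 - \<gamma> j" if "j \<in> {..<N}" for j
    proof -
      have "{..<N} - {0} = {1..<N}" by auto
      then have "(\<Sum>i<N. R i j) = R 0 j + (\<Sum>i\<in>{1..<N}. R i j)"
        using N by (simp add: sum.remove[of _ 0])
      moreover have "R 0 j = \<gamma> j"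
        using \<gamma>(1)[of j] that by (simp add: R_def \<nu>0 q0 h_def \<pi>_def)
      ultimately show ?thesis using col[of j] that by simp
    qed
    show "(\<Sum>j<N. R i j *\<^sub>R y j) = 1 *\<^sub>R x i" if i: "i \<in> {1..<N}" for i
    proof -
      have "(\<Sum>j<N. R i j *\<^sub>R y j) - x i = (\<Sum>j<N. R i j *\<^sub>R (y j - x i))"
        using row[OF i] by (simp add: algebra_simps sum_subtractf flip: scaleR_sum_left)
      also have "\<dots> = cinner N (\<lambda>j. (y j - x i) * q i j) (q i) / of_real (\<nu> i)"
        unfolding cinner_def sum_divide_distrib
        by (intro sum.cong refl)
          (simp add: R_def scaleR_conv_of_real complex_norm_square del: of_real_power)
      finally show ?thesis using Aq[OF i] by simp
    qed
  qed
  then show ?thesis by blast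
qed

text \<open>All cofactors are monic of the same degree, so the leading coefficient is the total
  weight, which does not vanish.\<close>

lemma degree_cofactor_sum:
  fixes y :: "'j \<Rightarrow> complex"
  assumes "finite J" "sum \<omega> J \<noteq> 0"
  defines "F \<equiv> \<Sum>j\<in>J. Polynomial.smult (of_real (\<omega> j)) (\<Prod>l\<in>J-{j}. [:- y l, 1:])"
  shows "degree F = card J - 1" and "lead_coeff F = of_real (sum \<omega> J)"
proof -
  have deg: "degree (\<Prod>l\<in>J-{j}. [:- y l, 1:]) = card J - 1" if "j \<in> J" for j
    using that assms(1) by (simp add: degree_linear_prod)
  have "poly.coeff (\<Prod>l\<in>J-{j}. [:- y l, 1:]) (card J - 1) = 1" if "j \<in> J" for j
    using deg[OF that] monic_linear_prod[of y "J - {j}"] by simp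
  then have c: "poly.coeff F (card J - 1) = of_real (sum \<omega> J)"
    by (simp add: F_def coeff_sum)
  have "degree F \<le> card J - 1"
    unfolding F_def using deg by (intro degree_sum_le assms(1) order_trans[OF degree_smult_le]) auto
  moreover have "card J - 1 \<le> degree F"
    using assms(2) by (intro le_degree) (simp only: c of_real_eq_0_iff not_False_eq_True)
  ultimately show "degree F = card J - 1" by simp
  with c show "lead_coeff F = of_real (sum \<omega> J)" by simp
qed

lemma transport_reindex:
  assumes M: "transport M I a x J b y" and f: "bij_betw f I' I" and g: "bij_betw g J' J"
  shows "transport (\<lambda>i j. M (f i) (g j)) I' (\<lambda>i. a (f i)) (\<lambda>i. x (f i)) J' (\<lambda>j. b (g j)) (\<lambda>j. y (g j))"
  unfolding transport_def
proof (intro conjI ballI)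
  have fI: "f i \<in> I" if "i \<in> I'" for i using bij_betwE[OF f] that by blast
  have gJ: "g j \<in> J" if "j \<in> J'" for j using bij_betwE[OF g] that by blast
  show "0 \<le> M (f i) (g j)" if "i \<in> I'" "j \<in> J'" for i j
    using transport_nonneg[OF M fI gJ] that .
  show "(\<Sum>j\<in>J'. M (f i) (g j)) = a (f i)" if "i \<in> I'" for i
    unfolding sum.reindex_bij_betw[OF g, of "M (f i)"] by (rule transport_row[OF M fI[OF that]])
  show "(\<Sum>i\<in>I'. M (f i) (g j)) = b (g j)" if "j \<in> J'" for j
    unfolding sum.reindex_bij_betw[OF f, of "\<lambda>i. M i (g j)"] by (rule transport_col[OF M gJ[OF that]])
  show "(\<Sum>j\<in>J'. M (f i) (g j) *\<^sub>R y (g j)) = a (f i) *\<^sub>R x (f i)" if "i \<in> I'" for i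
    unfolding sum.reindex_bij_betw[OF g, of "\<lambda>j. M (f i) j *\<^sub>R y j"]
    by (rule transport_mean[OF M fI[OF that]])
qed

text \<open>A repeated node \<open>y a = y b\<close> is a zero of the combination; splitting it off and merging the two
  weights reduces the number of nodes.\<close>

lemma transport_of_nodes:
  fixes x :: "'i \<Rightarrow> complex" and y :: "'j \<Rightarrow> complex"
  assumes "finite I" "finite J" "\<And>j. j \<in> J \<Longrightarrow> 0 < \<gamma> j" "sum \<gamma> J = 1"
    and "(\<Prod>i\<in>I. [:- x i, 1:]) =
      (\<Sum>j\<in>J. Polynomial.smult (of_real (\<gamma> j)) (\<Prod>l\<in>J-{j}. [:- y l, 1:]))"
  shows "\<exists>R. transport R I (\<lambda>_. 1) x J (\<lambda>j. 1 - \<gamma> j) y"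
  using assms
proof (induction "card J" arbitrary: I J \<gamma> rule: less_induct)
  case less
  note fin = \<open>finite I\<close> \<open>finite J\<close> and \<gamma> = less.prems(3,4) and F = less.prems(5)
  define P where "P K j = (\<Prod>l\<in>K-{j}. [:- y l, 1:])" for K j
  have F': "(\<Prod>i\<in>I. [:- x i, 1:]) = (\<Sum>j\<in>J. Polynomial.smult (of_real (\<gamma> j)) (P J j))"
    using F by (simp add: P_def)
  have J: "J \<noteq> {}" using \<gamma>(2) by auto
  show ?case
  proof (cases "inj_on y J")
    case True
    have cI: "card I = card J - 1"
      using degree_cofactor_sum(1)[of J \<gamma> y] fin \<gamma> by (simp add: degree_linear_prod flip: F)
    define N where "N = card J"
    obtain g where g: "bij_betw g {..<N} J"
      using ex_bij_betw_nat_finite[OF fin(2)] by (auto simp: N_def atLeast0LessThan)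
    \<comment> \<open>The numbering starts at \<open>1\<close> because index \<open>0\<close> is
      reserved for the vector \<open>u\<close>.\<close>
    obtain f where f: "bij_betw f {1..<N} I"
      using finite_same_card_bij[of "{1..<N}" I] fin cI by (auto simp: N_def)
    have inj: "inj_on g {..<N}" and img: "g ` {..<N} = J" using g by (auto simp: bij_betw_def)
    have F'': "(\<Prod>i\<in>{1..<N}. [:- x (f i), 1:]) =
      (\<Sum>j<N. Polynomial.smult (of_real (\<gamma> (g j))) (\<Prod>l\<in>{..<N}-{j}. [:- y (g l), 1:]))"
    proof -
      have "P J (g j) = (\<Prod>l\<in>{..<N}-{j}. [:- y (g l), 1:])" if "j < N" for j
      proof -
        have "bij_betw g ({..<N} - {j}) (J - {g j})"
          using bij_betw_DiffI[OF g, of "{j}" "{g j}"] that by (auto simp: bij_betw_def img[symmetric])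
        from prod.reindex_bij_betw[OF this, of "\<lambda>l. [:- y l, 1:]"] show ?thesis
          by (simp add: P_def)
      qed
      then have "(\<Sum>j<N. Polynomial.smult (of_real (\<gamma> (g j))) (\<Prod>l\<in>{..<N}-{j}. [:- y (g l), 1:])) =
          (\<Sum>j\<in>J. Polynomial.smult (of_real (\<gamma> j)) (P J j))"
        using sum.reindex_bij_betw[OF g, of "\<lambda>j. Polynomial.smult (of_real (\<gamma> j)) (P J j)"] by simp
      then show ?thesis
        unfolding F'[symmetric] by (simp only: prod.reindex_bij_betw[OF f, of "\<lambda>i. [:- x i, 1:]"])
    qed
    have "\<exists>R. transport R {1..<N} (\<lambda>_. 1) (\<lambda>i. x (f i)) {..<N} (\<lambda>j. 1 - \<gamma> (g j)) (\<lambda>j. y (g j))"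
    proof (rule transport_of_distinct_nodes[OF _ _ _ F''])
      show "inj_on (\<lambda>j. y (g j)) {..<N}"
        using comp_inj_on[OF inj, of y] True img by (simp add: o_def)
      show "(\<Sum>j<N. \<gamma> (g j)) = 1"
        using \<gamma>(2) by (simp add: sum.reindex_bij_betw[OF g])
      show "0 < \<gamma> (g j)" if "j < N" for j
        using \<gamma>(1) img that by auto
    qed
    then obtain R where
      R: "transport R {1..<N} (\<lambda>_. 1) (\<lambda>i. x (f i)) {..<N} (\<lambda>j. 1 - \<gamma> (g j)) (\<lambda>j. y (g j))" ..
    define f' where "f' = inv_into {1..<N} f"
    define g' where "g' = inv_into {..<N} g"
    have f': "bij_betw f' I {1..<N}" and g': "bij_betw g' J {..<N}"
      using f g by (auto simp: f'_def g'_def bij_betw_inv_into)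
    have "transport (\<lambda>i j. R (f' i) (g' j)) I (\<lambda>_. 1) x J (\<lambda>j. 1 - \<gamma> j) y"
    proof (rule transport_cong[OF transport_reindex[OF R f' g']])
      have "f (f' i) = i" if "i \<in> I" for i
        unfolding f'_def by (rule bij_betw_inv_into_right[OF f that])
      then show "x i = x (f (f' i))" if "i \<in> I" for i using that by simp
      have "g (g' j) = j" if "j \<in> J" for j
        unfolding g'_def by (rule bij_betw_inv_into_right[OF g that])
      then show "1 - \<gamma> j = 1 - \<gamma> (g (g' j))" "y j = y (g (g' j))" if "j \<in> J" for j
        using that by simp_all
    qed simp
    then show ?thesis by blast
  next
    case False
    then obtain a b where ab: "a \<in> J" "b \<in> J" "a \<noteq> b" "y a = y b" by (auto simp: inj_on_def)
    define K where "K = J - {b}"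
    define \<gamma>' where "\<gamma>' j = (if j = a then \<gamma> a + \<gamma> b else \<gamma> j)" for j
    have K: "finite K" "a \<in> K" "b \<notin> K" "J = insert b K" using ab fin by (auto simp: K_def)
    have \<gamma>ab: "0 < \<gamma> a" "0 < \<gamma> b" "\<gamma> a + \<gamma> b \<le> 1"
    proof -
      show "0 < \<gamma> a" "0 < \<gamma> b" using \<gamma> ab by auto
      have "sum \<gamma> {a, b} \<le> sum \<gamma> J"
        using ab \<gamma> fin by (intro sum_mono2) (auto intro: less_imp_le)
      then show "\<gamma> a + \<gamma> b \<le> 1" using ab \<gamma> by simp
    qed
    define X where "X = [:- y a, 1:]"
    \<comment> \<open>The cofactors at \<open>a\<close> and \<open>b\<close> coincide because
      \<open>y a = y b\<close>, so their weights add up; every cofactor retains one factor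
      \<open>X\<close>.\<close>
    have merge: "(\<Sum>j\<in>J. Polynomial.smult (of_real (\<gamma> j)) (P J j)) =
        X * (\<Sum>j\<in>K. Polynomial.smult (of_real (\<gamma>' j)) (P K j))"
    proof -
      have PX: "P J j = X * P K j" if "j \<in> K" for j
      proof -
        have "J - {j} = insert b (K - {j})" using K that by auto
        then show ?thesis using K ab by (simp add: P_def X_def)
      qed
      have Pb: "P J b = X * P K a"
      proof -
        have "J - {b} = K" using K by auto
        then show ?thesis
          using prod.remove[OF K(1,2), of "\<lambda>l. [:- y l, 1:]"] by (simp only: P_def X_def)
      qed
      have "(\<Sum>j\<in>J. Polynomial.smult (of_real (\<gamma> j)) (P J j)) =
          Polynomial.smult (of_real (\<gamma> b)) (X * P K a) +
          (\<Sum>j\<in>K. Polynomial.smult (of_real (\<gamma> j)) (X * P K j))"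
        using K Pb PX by simp
      also have "\<dots> = X * (\<Sum>j\<in>K. Polynomial.smult (of_real (\<gamma>' j)) (P K j))"
        using K by (simp add: sum.remove[of K a] \<gamma>'_def sum_distrib_left smult_add_left algebra_simps)
      finally show ?thesis .
    qed
    have "poly (\<Prod>i\<in>I. [:- x i, 1:]) (y a) = 0"
      unfolding F' merge by (simp add: X_def)
    then obtain i0 where i0: "i0 \<in> I" "x i0 = y a"
      using fin by (auto simp: poly_linear_prod)
    define I' where "I' = I - {i0}"
    have I': "finite I'" "i0 \<notin> I'" "I = insert i0 I'" using fin i0 by (auto simp: I'_def)
    have "X * (\<Prod>i\<in>I'. [:- x i, 1:]) = X * (\<Sum>j\<in>K. Polynomial.smult (of_real (\<gamma>' j)) (P K j))"
      using F' merge I' i0 by (simp add: X_def)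
    moreover have "X \<noteq> 0" by (simp add: X_def)
    ultimately have FK: "(\<Prod>i\<in>I'. [:- x i, 1:]) =
        (\<Sum>j\<in>K. Polynomial.smult (of_real (\<gamma>' j)) (\<Prod>l\<in>K-{j}. [:- y l, 1:]))"
      by (simp add: P_def)
    have "sum \<gamma>' K = 1"
      using \<gamma>(2) K by (simp add: sum.remove[of K a] \<gamma>'_def)
    moreover have "card K < card J" using K by simp
    moreover have "0 < \<gamma>' j" if "j \<in> K" for j using \<gamma>(1) K add_pos_pos[OF \<gamma>ab(1,2)] that by (auto simp: \<gamma>'_def)
    ultimately obtain R where R: "transport R I' (\<lambda>_. 1) x K (\<lambda>j. 1 - \<gamma>' j) y"
      using less.hyps[OF _ I'(1) K(1) _ _ FK] by auto
    \<comment> \<open>The smaller plan puts \<open>1 - \<gamma> a - \<gamma> b\<close> on the merged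
      node. The split-off zero \<open>x i0 = y a\<close> sends its whole mass \<open>1\<close> there
      too, and \<open>\<theta>\<close> divides the total into \<open>1 - \<gamma> a\<close> for
      \<open>a\<close> and \<open>1 - \<gamma> b\<close> for \<open>b\<close>.\<close>
    define \<theta> where "\<theta> = (1 - \<gamma> a) / (2 - \<gamma> a - \<gamma> b)"
    have \<theta>: "0 \<le> \<theta>" "\<theta> \<le> 1" and \<theta>a: "\<theta> * (2 - \<gamma> a - \<gamma> b) = 1 - \<gamma> a"
      using \<gamma>ab by (auto simp: \<theta>_def)
    define T where "T i = (if i = i0 then 1 else R i a)" for i
    define R' where "R' i j = (if j = a then \<theta> * T i else if j = b then (1 - \<theta>) * T i
        else if i = i0 then 0 else R i j)" for i j
    have Ra: "R' i a = \<theta> * T i" and Rb: "R' i b = (1 - \<theta>) * T i" for i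
      using ab by (auto simp: R'_def)
    have Rrest: "R' i j = (if i = i0 then 0 else R i j)" if "j \<in> K - {a}" for i j
      using that K by (auto simp: R'_def)
    have sumK: "(\<Sum>j\<in>K. u j) = u a + (\<Sum>j\<in>K-{a}. u j)" for u :: "'j \<Rightarrow> real"
      using K by (simp add: sum.remove)
    have sumK': "(\<Sum>j\<in>K. u j) = u a + (\<Sum>j\<in>K-{a}. u j)" for u :: "'j \<Rightarrow> complex"
      using K by (simp add: sum.remove)
    have T: "(\<Sum>i\<in>I. T i) = 2 - \<gamma> a - \<gamma> b"
    proof -
      have "(\<Sum>i\<in>I'. T i) = (\<Sum>i\<in>I'. R i a)"
        using I' by (intro sum.cong) (auto simp: T_def)
      then show ?thesis
        using I' transport_col[OF R K(2)] by (simp add: T_def \<gamma>'_def)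
    qed
    have "transport R' I (\<lambda>_. 1) x J (\<lambda>j. 1 - \<gamma> j) y"
      unfolding transport_def
    proof (intro conjI ballI)
      show "0 \<le> R' i j" if "i \<in> I" "j \<in> J" for i j
      proof -
        have "0 \<le> T i" using that I' K transport_nonneg[OF R, of i a] by (auto simp: T_def)
        then show ?thesis using that \<theta> I' K transport_nonneg[OF R, of i j] by (auto simp: R'_def)
      qed
      show "(\<Sum>j\<in>J. R' i j) = 1" if i: "i \<in> I" for i
      proof -
        have "(\<Sum>j\<in>J. R' i j) = T i + (\<Sum>j\<in>K-{a}. if i = i0 then 0 else R i j)"
          using K Ra Rb Rrest by (simp add: sumK algebra_simps)
        also have "\<dots> = 1"
          using transport_row[OF R, of i] i I' by (auto simp: T_def sumK)
        finally show ?thesis .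
      qed
      show "(\<Sum>i\<in>I. R' i j) = 1 - \<gamma> j" if j: "j \<in> J" for j
      proof -
        consider "j = a" | "j = b" "j \<noteq> a" | "j \<noteq> a" "j \<noteq> b" by blast
        then show ?thesis
        proof cases
          case 1
          then show ?thesis using T \<theta>a by (simp add: R'_def flip: sum_distrib_left)
        next
          case 2
          then have "(\<Sum>i\<in>I. R' i j) = (1 - \<theta>) * (2 - \<gamma> a - \<gamma> b)"
            using T by (simp add: R'_def flip: sum_distrib_left)
          also have "\<dots> = 1 - \<gamma> b" using \<theta>a by (simp add: left_diff_distrib)
          finally show ?thesis using 2 by simp
        next
          case 3
          then have "(\<Sum>i\<in>I. R' i j) = (\<Sum>i\<in>I'. R i j)"
            using I' by (auto simp: R'_def intro!: sum.cong)
          then show ?thesis using transport_col[OF R, of j] 3 j K by (simp add: \<gamma>'_def)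
        qed
      qed
      show "(\<Sum>j\<in>J. R' i j *\<^sub>R y j) = 1 *\<^sub>R x i" if i: "i \<in> I" for i
      proof -
        have "(\<Sum>j\<in>J. R' i j *\<^sub>R y j) =
            T i *\<^sub>R y a + (\<Sum>j\<in>K-{a}. (if i = i0 then 0 else R i j) *\<^sub>R y j)"
          using K ab Ra Rb Rrest by (simp add: sumK' algebra_simps flip: scaleR_add_left)
        also have "\<dots> = x i"
          using transport_mean[OF R, of i] i I' i0 by (auto simp: T_def sumK')
        finally show ?thesis by simp
      qed
    qed
    then show ?thesis by blast
  qed
qed

text \<open>Reduction to total weight one: comparing leading coefficients shows that
  \<open>c\<close> must be \<open>sum \<omega> J\<close>.\<close>

lemma transport_of_weighted_nodes:
  fixes x :: "'i \<Rightarrow> complex" and y :: "'j \<Rightarrow> complex"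
  assumes fin: "finite I" "finite J" and J: "J \<noteq> {}" and \<omega>: "\<And>j. j \<in> J \<Longrightarrow> 0 < \<omega> j"
    and F: "Polynomial.smult c (\<Prod>i\<in>I. [:- x i, 1:]) =
      (\<Sum>j\<in>J. Polynomial.smult (of_real (\<omega> j)) (\<Prod>l\<in>J-{j}. [:- y l, 1:]))"
  shows "\<exists>R. transport R I (\<lambda>_. 1) x J (\<lambda>j. 1 - \<omega> j / sum \<omega> J) y"
proof (rule transport_of_nodes[OF fin])
  have pos: "0 < sum \<omega> J" using fin J \<omega> by (intro sum_pos)
  then show "0 < \<omega> j / sum \<omega> J" if "j \<in> J" for j using \<omega>[OF that] by simp
  show "(\<Sum>j\<in>J. \<omega> j / sum \<omega> J) = 1" using pos by (simp flip: sum_divide_distrib)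
  have "lead_coeff (Polynomial.smult c (\<Prod>i\<in>I. [:- x i, 1:])) = of_real (sum \<omega> J)"
    unfolding F using pos by (intro degree_cofactor_sum fin) simp
  then have c: "c = of_real (sum \<omega> J)"
    by (simp only: lead_coeff_smult monic_linear_prod mult_1_right)
  have "(\<Prod>i\<in>I. [:- x i, 1:]) = Polynomial.smult (inverse c) (Polynomial.smult c (\<Prod>i\<in>I. [:- x i, 1:]))"
    using pos by (simp add: c del: of_real_sum)
  also have "\<dots> = (\<Sum>j\<in>J. Polynomial.smult (of_real (\<omega> j / sum \<omega> J)) (\<Prod>l\<in>J-{j}. [:- y l, 1:]))"
    unfolding F
    by (rule poly_eqI) (simp add: coeff_sum sum_distrib_left c divide_inverse mult_ac del: of_real_sum)
  finally show "(\<Prod>i\<in>I. [:- x i, 1:]) =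
      (\<Sum>j\<in>J. Polynomial.smult (of_real (\<omega> j / sum \<omega> J)) (\<Prod>l\<in>J-{j}. [:- y l, 1:]))" .
qed

section \<open>Zeros of higher derivatives\<close>

lemma pderiv_linear_prod:
  fixes z :: "'a \<Rightarrow> complex"
  shows "pderiv (\<Prod>i\<in>A. [:- z i, 1:]) = (\<Sum>i\<in>A. \<Prod>l\<in>A-{i}. [:- z l, 1:])"
  by (simp add: pderiv_prod pderiv_pCons)

text \<open>The derivative is the sum of all cofactors with weight \<open>1\<close>, so passing from
  \<open>N\<close> zeros to \<open>N - 1\<close> gives column masses \<open>1 - 1 / N\<close>.
  Composing these steps, the factors \<open>(N - 1) / N\<close> telescope.\<close>

lemma transport_higher_pderiv:
  fixes s :: "nat \<Rightarrow> complex"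
  assumes S: "S = Polynomial.smult c (\<Prod>j<n. [:- s j, 1:])" "c \<noteq> 0" and "i \<le> n"
  shows "\<exists>w d R. d \<noteq> 0 \<and> (pderiv ^^ i) S = Polynomial.smult d (\<Prod>t<n-i. [:- w t, 1:]) \<and>
    transport R {..<n-i} (\<lambda>_. 1) w {..<n} (\<lambda>_. real (n - i) / real n) s"
  using \<open>i \<le> n\<close>
proof (induction i)
  case 0
  have "transport (\<lambda>i j. if i = j then 1 else 0) {..<n} (\<lambda>_. 1) s {..<n} (\<lambda>_. 1) s"
    by (intro transport_refl) auto
  then have "transport (\<lambda>i j. if i = j then 1 else 0) {..<n} (\<lambda>_. 1) s {..<n} (\<lambda>_. real n / real n) s"
    by (rule transport_cong) auto
  then have "c \<noteq> 0 \<and> (pderiv ^^ 0) S = Polynomial.smult c (\<Prod>t<n-0. [:- s t, 1:]) \<and>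
      transport (\<lambda>i j. if i = j then 1 else 0) {..<n-0} (\<lambda>_. 1) s {..<n} (\<lambda>_. real (n - 0) / real n) s"
    using S by simp
  then show ?case by blast
next
  case (Suc i)
  define N where "N = n - i"
  have N: "N \<ge> 1" "n - Suc i = N - 1" using Suc.prems by (auto simp: N_def)
  obtain w d R where d: "d \<noteq> 0" and w: "(pderiv ^^ i) S = Polynomial.smult d (\<Prod>t<N. [:- w t, 1:])"
    and R: "transport R {..<N} (\<lambda>_. 1) w {..<n} (\<lambda>_. real N / real n) s"
    using Suc unfolding N_def by auto
  define p where "p = (pderiv ^^ i) S"
  have deg: "degree p = N" using d by (simp add: p_def w degree_linear_prod)
  have p': "pderiv p \<noteq> 0" using deg N by (simp add: pderiv_eq_0_iff)
  obtain w' where w': "Polynomial.smult (lead_coeff (pderiv p)) (\<Prod>t<degree (pderiv p). [:- w' t, 1:]) = pderiv p"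
    using complex_poly_decompose'[of "pderiv p"] by blast
  define d' where "d' = lead_coeff (pderiv p)"
  have d': "d' \<noteq> 0" using p' by (simp add: d'_def)
  have w'': "pderiv p = Polynomial.smult d' (\<Prod>t<N-1. [:- w' t, 1:])"
    using w' deg by (simp add: d'_def degree_pderiv)
  have "pderiv p = Polynomial.smult d (\<Sum>j<N. \<Prod>l\<in>{..<N}-{j}. [:- w l, 1:])"
    unfolding p_def w pderiv_smult pderiv_linear_prod ..
  then have "Polynomial.smult (d' / d) (\<Prod>t<N-1. [:- w' t, 1:]) =
      (\<Sum>j<N. Polynomial.smult (of_real 1) (\<Prod>l\<in>{..<N}-{j}. [:- w l, 1:]))"
    using d arg_cong[OF w'', of "Polynomial.smult (1 / d)"] by simp
  then have "\<exists>R'. transport R' {..<N-1} (\<lambda>_. 1) w' {..<N} (\<lambda>j. 1 - 1 / (\<Sum>j<N. 1)) w"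
    using N by (intro transport_of_weighted_nodes) (auto simp: lessThan_empty_iff)
  then obtain R' where "transport R' {..<N-1} (\<lambda>_. 1) w' {..<N} (\<lambda>j. 1 - 1 / (\<Sum>j<N. 1)) w" ..
  then have R': "transport R' {..<N-1} (\<lambda>_. 1) w' {..<N} (\<lambda>j. (1 - 1 / real N) * 1) w"
    by simp
  have "(1 - 1 / real N) * real N = real (N - 1)"
    using N by (simp add: left_diff_distrib of_nat_diff)
  then have e: "(1 - 1 / real N) * (real N / real n) = real (N - 1) / real n"
    by simp
  have "transport (\<lambda>i j. (1 - 1 / real N) * R i j) {..<N} (\<lambda>_. (1 - 1 / real N) * 1) w
      {..<n} (\<lambda>_. real (N - 1) / real n) s"
    unfolding e[symmetric] using N by (intro transport_scale[OF R]) simp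
  from transport_trans[OF R' this] obtain R'' where
    "transport R'' {..<N-1} (\<lambda>_. 1) w' {..<n} (\<lambda>_. real (N - 1) / real n) s"
    by auto
  then show ?case
    using d' w'' unfolding N(2) p_def by (intro exI[of _ w'] exI[of _ d'] exI[of _ R'']) simp
qed

section \<open>Factorization over the listed zeros, and passage to row stochastic matrices\<close>

lemma complex_poly_eq_linear_prod:
  fixes P :: "complex poly"
  assumes "proots P = image_mset z (mset_set A)"
  shows "P = Polynomial.smult (lead_coeff P) (\<Prod>i\<in>A. [:- z i, 1:])"
  using complex_poly_decompose_multiset[of P]
  by (simp add: assms image_mset.compositionality o_def prod_unfold_prod_mset)

text \<open>Positive source masses allow each row to be normalized. The target weights sum to
  \<open>1\<close> because a plan preserves the total mass.\<close>

lemma weighted_majorized_of_transport: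
  assumes M: "transport M {..<q} a x {..<p} b y"
    and a: "\<And>i. i < q \<Longrightarrow> 0 < a i" "(\<Sum>i<q. a i) = 1"
  shows "(Matrix.vec q x, Matrix.vec q a) \<prec>\<^sub>w (Matrix.vec p y, Matrix.vec p b)"
proof -
  define R where "R = Matrix.mat q p (\<lambda>(i, j). M i j / a i)"
  have M0: "0 \<le> M i j" if "i < q" "j < p" for i j
    using transport_nonneg[OF M] that by simp
  have a0: "a i \<noteq> 0" if "i < q" for i using a(1)[OF that] by simp
  have b: "0 \<le> b j" if "j < p" for j
    using transport_col[OF M, of j] M0 that by (metis lessThan_iff sum_nonneg)
  have "(\<Sum>j<p. b j) = (\<Sum>j<p. \<Sum>i<q. M i j)" using transport_col[OF M] by simp
  also have "\<dots> = (\<Sum>i<q. a i)" using transport_row[OF M] by (subst sum.swap) simp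
  finally have b1: "(\<Sum>j<p. b j) = 1" using a by simp
  have wv: "weight_vec (Matrix.vec l u)" if "\<And>i. i < l \<Longrightarrow> 0 \<le> u i" "(\<Sum>i<l. u i) = 1" for l u
    using that member_le_sum[of _ "{..<l}" u] by (fastforce simp: weight_vec_def)
  have "row_stochastic R"
    unfolding row_stochastic_def using a a0 M0 transport_row[OF M]
    by (auto simp: R_def less_imp_le simp flip: sum_divide_distrib)
  moreover have "Matrix.vec q x = map_mat complex_of_real R *\<^sub>v Matrix.vec p y"
  proof (rule eq_vecI)
    fix i assume i: "i < dim_vec (map_mat complex_of_real R *\<^sub>v Matrix.vec p y)"
    then have i: "i < q" by (simp add: R_def)
    have "(map_mat complex_of_real R *\<^sub>v Matrix.vec p y) $ i = (\<Sum>j<p. of_real (M i j / a i) * y j)"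
      using i by (simp add: R_def scalar_prod_def atLeast0LessThan)
    also have "\<dots> = (1 / a i) *\<^sub>R (\<Sum>j<p. M i j *\<^sub>R y j)"
      unfolding scaleR_sum_right by (simp add: scaleR_conv_of_real)
    also have "\<dots> = x i" using transport_mean[OF M, of i] a(1)[OF i] i by simp
    finally show "Matrix.vec q x $ i = (map_mat complex_of_real R *\<^sub>v Matrix.vec p y) $ i"
      using i by simp
  qed (simp add: R_def)
  moreover have "mat_of_row (Matrix.vec p b) = mat_of_row (Matrix.vec q a) * R"
  proof (rule eq_matI)
    fix i j assume "i < dim_row (mat_of_row (Matrix.vec q a) * R)"
      "j < dim_col (mat_of_row (Matrix.vec q a) * R)"
    then have ij: "i = 0" "j < p" by (auto simp: R_def)
    have "(mat_of_row (Matrix.vec q a) * R) $$ (i, j) = (\<Sum>i<q. a i * (M i j / a i))"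
      using ij by (simp add: R_def scalar_prod_def atLeast0LessThan mat_of_row_def)
    also have "\<dots> = b j"
      using transport_col[OF M, of j] ij a by (simp add: a0 cong: sum.cong_simp)
    finally show "mat_of_row (Matrix.vec p b) $$ (i, j) = (mat_of_row (Matrix.vec q a) * R) $$ (i, j)"
      using ij by (simp add: mat_of_row_def)
  qed (auto simp: R_def)
  moreover have "R \<in> carrier_mat q p" by (simp add: R_def)
  ultimately show ?thesis
    unfolding weighted_majorized_def using wv[of q a] wv[of p b] a b b1
    by (auto intro: less_imp_le)
qed

section \<open>Combining both majorizations for the differential equation\<close>

theorem theorem4:
  fixes k p n r :: nat
    and \<zeta> s v :: "nat \<Rightarrow> complex" and a :: "nat \<Rightarrow> real"
    and Q2 Q1 S V :: "complex poly"
    and \<alpha> D :: real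
    and lhs rhs :: "(complex \<Rightarrow> real) \<Rightarrow> real"
  assumes "k \<ge> 2" and "p \<ge> k" and "n \<ge> 1" and "r = p - k"
    and "\<And>l. l < p \<Longrightarrow> a l > 0"
    and "Q2 = (\<Prod>l<p. [:- \<zeta> l, 1:])"
    and "\<And>z. z \<notin> \<zeta> ` {..<p} \<Longrightarrow>
           poly Q1 z / poly Q2 z = (\<Sum>l<p. complex_of_real (a l) / (z - \<zeta> l))"
    and "degree S = n" and "V \<noteq> 0" and "degree V = r"
    and "Q2 * (pderiv ^^ k) S + Q1 * (pderiv ^^ (k - 1)) S + V * S = 0"
    and "proots S = image_mset s (mset_set {..<n})"
    and "proots V = image_mset v (mset_set {..<r})"
    and "\<alpha> = real n - real k + 1 + (\<Sum>l<p. a l)"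
    and "D = (real p - 1) * \<alpha> + real n - real k + 1"
    and "\<And>f. lhs f = (\<Sum>i<r. f (v i)) +
           (1 - (1 - (real k - 1) / real n) * (1 - 1 / \<alpha>)) * (\<Sum>j<n. f (s j))"
    and "\<And>f. rhs f = (\<Sum>l<p. (1 - a l / \<alpha>) * f (\<zeta> l))"
  shows "(\<forall>f. convex_on UNIV f \<longrightarrow> lhs f \<le> rhs f) \<and>
    (\<forall>f. strictly_convex_on UNIV f \<and> lhs f = rhs f \<longrightarrow> collinear (\<zeta> ` {..<p})) \<and>
    (let majorization =
       (vec r v @\<^sub>v vec n s,
        vec r (\<lambda>_. \<alpha> / D) @\<^sub>v
        vec n (\<lambda>_. ((real k - 1) * \<alpha> + real n - real k + 1) / (real n * D)))
       \<prec>\<^sub>w (vec p \<zeta>, vec p (\<lambda>l. (\<alpha> - a l) / D))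
     in ((\<forall>f. convex_on UNIV f \<longrightarrow> lhs f \<le> rhs f) \<longleftrightarrow> majorization) \<and> majorization)"
proof -
  note k = assms(1) and n = assms(3) and r = assms(4) and a = assms(5)
    and Q2 = assms(6) and Q1 = assms(7) and ode = assms(11)
    and \<alpha>_def = assms(14) and D_def = assms(15) and lhs = assms(16) and rhs = assms(17)
  define m where "m = n - (k - 1)"
  define T where "T = (pderiv ^^ (k - 1)) S"
  have S0: "S \<noteq> 0" using assms(8) n by auto
  have k': "(pderiv ^^ k) S = pderiv T"
  proof -
    have "k = Suc (k - 1)" using k by simp
    then show ?thesis unfolding T_def by (metis funpow.simps(2) o_apply)
  qed
  have ode': "Q2 * pderiv T + Q1 * T = - (V * S)"
    using ode unfolding k' T_def[symmetric] by (simp add: eq_neg_iff_add_eq_0)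
  \<comment> \<open>Otherwise \<open>T = 0\<close>, and the equation would reduce to
    \<open>V * S = 0\<close>. This makes the truncated difference \<open>m\<close> the true degree
    of \<open>T\<close>.\<close>
  have kn: "k - 1 \<le> n"
  proof (rule ccontr)
    assume "\<not> k - 1 \<le> n"
    then have "degree ((pderiv ^^ (k - 2)) S) = 0" and "k - 1 = Suc (k - 2)"
      using k by (auto simp: degree_higher_pderiv assms(8))
    then have "T = 0" unfolding T_def by (simp add: pderiv_eq_0_iff)
    then show False using ode' S0 assms(9) by simp
  qed
  have m: "real m = real n - real k + 1" "m < n" using kn k n by (auto simp: m_def)

  \<comment> \<open>Disjoint sums keep zeros of different origin apart even where their values
    coincide.\<close>
  define I :: "(nat + nat) set" where "I = {..<r} <+> {..<n}"
  define x where "x = case_sum v s"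
  define ls where "ls = lead_coeff S"
  define lv where "lv = lead_coeff V"
  have ls: "ls \<noteq> 0" "S = Polynomial.smult ls (\<Prod>j<n. [:- s j, 1:])"
    using S0 complex_poly_eq_linear_prod[OF assms(12)] by (auto simp: ls_def)
  have lv: "lv \<noteq> 0" "V = Polynomial.smult lv (\<Prod>i<r. [:- v i, 1:])"
    using assms(9) complex_poly_eq_linear_prod[OF assms(13)] by (auto simp: lv_def)
  obtain w d C where d: "d \<noteq> 0" and w: "T = Polynomial.smult d (\<Prod>t<m. [:- w t, 1:])"
    and C: "transport C {..<m} (\<lambda>_. 1) w {..<n} (\<lambda>_. real m / real n) s"
    using transport_higher_pderiv[OF ls(2,1) kn] unfolding m_def T_def by blast
  define J :: "(nat + nat) set" where "J = {..<p} <+> {..<m}"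
  define y where "y = case_sum \<zeta> w"
  define \<omega> where "\<omega> = case_sum a (\<lambda>_::nat. 1)"
  define W where "W = (\<Prod>t<m. [:- w t, 1:])"
  have fin: "finite I" "finite J" by (auto simp: I_def J_def)
  have \<omega>: "0 < \<omega> j" if "j \<in> J" for j
    using that a by (auto simp: J_def \<omega>_def)
  \<comment> \<open>This identifies \<open>\<alpha>\<close> as the total weight: each pole counts
    \<open>a l\<close>, each of the \<open>m\<close> zeros of \<open>T\<close> counts
    \<open>1\<close>.\<close>
  have \<omega>_sum: "sum \<omega> J = \<alpha>"
    using m by (simp add: J_def \<omega>_def sum.Plus \<alpha>_def)
  have J_ne: "J \<noteq> {}" using assms(1,2) by (auto simp: J_def lessThan_empty_iff)
  have \<alpha>: "0 < \<alpha>" unfolding \<omega>_sum[symmetric] using fin J_ne \<omega> by (intro sum_pos)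
  \<comment> \<open>\<open>Q1\<close> is known only through its values off the points
    \<open>\<zeta> l\<close>; two polynomials that agree outside a finite set are equal.\<close>
  have Q1': "Q1 = (\<Sum>l<p. Polynomial.smult (of_real (a l)) (\<Prod>i\<in>{..<p}-{l}. [:- \<zeta> i, 1:]))"
    (is "_ = ?Q")
  proof -
    have "poly Q1 z = poly ?Q z" if z: "z \<notin> \<zeta> ` {..<p}" for z
    proof -
      have nz: "z - \<zeta> i \<noteq> 0" if "i < p" for i using z that by auto
      have q2: "poly Q2 z = (\<Prod>i<p. z - \<zeta> i)" by (simp add: Q2 poly_linear_prod)
      have q2_ne: "poly Q2 z \<noteq> 0" unfolding q2 using nz by simp
      have "poly Q1 z = poly Q2 z * (\<Sum>l<p. complex_of_real (a l) / (z - \<zeta> l))"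
        using Q1[OF z] q2_ne by (simp add: field_simps)
      also have "\<dots> = (\<Sum>l<p. complex_of_real (a l) * (\<Prod>i\<in>{..<p}-{l}. z - \<zeta> i))"
        unfolding sum_distrib_left
      proof (intro sum.cong refl)
        fix l assume l: "l \<in> {..<p}"
        have "poly Q2 z = (z - \<zeta> l) * (\<Prod>i\<in>{..<p}-{l}. z - \<zeta> i)"
          unfolding q2 by (rule prod.remove[OF finite_lessThan l])
        then show "poly Q2 z * (complex_of_real (a l) / (z - \<zeta> l)) =
            complex_of_real (a l) * (\<Prod>i\<in>{..<p}-{l}. z - \<zeta> i)"
          using nz[of l] l by simp
      qed
      finally show ?thesis by (simp add: poly_sum poly_linear_prod)
    qed
    then have "- (\<zeta> ` {..<p}) \<subseteq> {z. poly (Q1 - ?Q) z = 0}" by auto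
    moreover have "infinite (- (\<zeta> ` {..<p}))"
      by (simp add: infinite_UNIV_char_0 Compl_eq_Diff_UNIV)
    ultimately have "infinite {z. poly (Q1 - ?Q) z = 0}" using finite_subset by blast
    then show ?thesis using poly_roots_finite[of "Q1 - ?Q"] by auto
  qed
  \<comment> \<open>The equation divided by \<open>d\<close>: the cofactors at the
    \<open>\<zeta> l\<close> make up \<open>Q1 * W\<close>, those at the \<open>w t\<close> make up
    \<open>Q2 * pderiv W\<close>.\<close>
  have "Polynomial.smult (- (lv * ls) / d) (\<Prod>i\<in>I. [:- x i, 1:]) =
      (\<Sum>j\<in>J. Polynomial.smult (of_real (\<omega> j)) (\<Prod>l\<in>J-{j}. [:- y l, 1:]))"
  proof -
    have Jl: "(\<Prod>i\<in>J-{Inl l}. [:- y i, 1:]) = (\<Prod>i\<in>{..<p}-{l}. [:- \<zeta> i, 1:]) * W" for l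
    proof -
      have "J - {Inl l} = ({..<p} - {l}) <+> {..<m}" by (auto simp: J_def)
      then show ?thesis by (simp add: prod.Plus y_def W_def)
    qed
    have Jt: "(\<Prod>i\<in>J-{Inr t}. [:- y i, 1:]) = Q2 * (\<Prod>i\<in>{..<m}-{t}. [:- w i, 1:])" for t
    proof -
      have "J - {Inr t} = {..<p} <+> ({..<m} - {t})" by (auto simp: J_def)
      then show ?thesis by (simp add: prod.Plus y_def Q2)
    qed
    have split: "(\<Sum>j\<in>J. F j) = (\<Sum>l<p. F (Inl l)) + (\<Sum>t<m. F (Inr t))" for F :: "nat + nat \<Rightarrow> complex poly"
      by (simp add: J_def sum.Plus)
    have "(\<Sum>j\<in>J. Polynomial.smult (of_real (\<omega> j)) (\<Prod>l\<in>J-{j}. [:- y l, 1:])) = Q1 * W + Q2 * pderiv W"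
      unfolding split Jl Jt Q1'
      by (simp add: \<omega>_def W_def pderiv_linear_prod sum_distrib_left sum_distrib_right)
    moreover have "Polynomial.smult d (Q1 * W + Q2 * pderiv W) =
        Polynomial.smult (- (lv * ls)) (\<Prod>i\<in>I. [:- x i, 1:])"
    proof -
      have "Polynomial.smult d (Q1 * W + Q2 * pderiv W) = Q2 * pderiv T + Q1 * T"
        by (simp add: w W_def[symmetric] pderiv_smult smult_add_right)
      also have "\<dots> = Polynomial.smult (- (lv * ls)) (\<Prod>i\<in>I. [:- x i, 1:])"
        unfolding ode' by (subst ls(2), subst lv(2)) (simp add: I_def x_def prod.Plus mult.commute[of ls])
      finally show ?thesis .
    qed
    from arg_cong[OF this, of "Polynomial.smult (1 / d)"]
    have "Q1 * W + Q2 * pderiv W = Polynomial.smult (- (lv * ls) / d) (\<Prod>i\<in>I. [:- x i, 1:])"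
      using d by simp
    ultimately show ?thesis by simp
  qed
  from transport_of_weighted_nodes[OF fin J_ne \<omega> this]
  obtain R where R: "transport R I (\<lambda>_. 1) x J (\<lambda>j. 1 - \<omega> j / \<alpha>) y"
    unfolding \<omega>_sum by blast

  \<comment> \<open>The mass that \<open>R\<close> leaves at each \<open>w t\<close>. If
    \<open>m = 0\<close> there are no such points, and \<open>1 - 1 / \<alpha>\<close> could be
    negative, so \<open>0\<close> is used instead; \<open>\<beta>\<close> is \<open>0\<close> then
    in either case.\<close>
  define e where "e = (if m = 0 then 0 else 1 - 1 / \<alpha>)"
  define \<beta> where "\<beta> = e * (real m / real n)"
  have \<alpha>1: "1 < \<alpha>" if "m \<noteq> 0"
  proof -
    have "0 < (\<Sum>l<p. a l)" using a assms(1,2) by (intro sum_pos) (auto simp: lessThan_empty_iff)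
    then show ?thesis using that unfolding \<alpha>_def m(1)[symmetric] by simp
  qed
  have e: "0 \<le> e" "e < 1" using \<alpha> \<alpha>1 by (auto simp: e_def)
  \<comment> \<open>\<open>\<beta>\<close> is the mass that the composed plan sends to each target
    \<open>s j\<close>. Cancelling it against the unit mass of the source \<open>s j\<close> needs
    \<open>\<beta> < 1\<close>, which follows from \<open>m < n\<close>.\<close>
  have \<beta>: "0 \<le> \<beta>" "\<beta> < 1"
  proof -
    show "0 \<le> \<beta>" using e by (simp add: \<beta>_def)
    have "\<beta> \<le> real m / real n"
      unfolding \<beta>_def using mult_right_mono[of e 1 "real m / real n"] e by simp
    also have "\<dots> < 1" using m(2) by simp
    finally show "\<beta> < 1" .
  qed
  have a_le: "a l \<le> \<alpha>" if "l < p" for l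
    using member_le_sum[of "Inl l" J \<omega>] \<omega> fin that unfolding \<omega>_sum
    by (auto simp: J_def \<omega>_def less_imp_le)
  define c where "c = (\<lambda>l. 1 - a l / \<alpha>)"
  define Z :: "(nat + nat) set" where "Z = {..<p} <+> {..<n}"
  have "\<exists>R'. transport R' J (\<lambda>j. 1 - \<omega> j / \<alpha>) y Z (case_sum c (\<lambda>_. \<beta>)) (case_sum \<zeta> s)"
  proof -
    have "transport (\<lambda>i j. if i = j then c i else 0) {..<p} c \<zeta> {..<p} c \<zeta>"
      using a_le \<alpha> by (intro transport_refl) (auto simp: c_def)
    from transport_Plus[OF this transport_scale[OF C e(1)]]
    obtain R' where "transport R' J (case_sum c (\<lambda>_. e * 1)) y Z (case_sum c (\<lambda>_. \<beta>)) (case_sum \<zeta> s)"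
      unfolding J_def Z_def y_def \<beta>_def by blast
    then have "transport R' J (\<lambda>j. 1 - \<omega> j / \<alpha>) y Z (case_sum c (\<lambda>_. \<beta>)) (case_sum \<zeta> s)"
      by (rule transport_cong) (auto simp: J_def \<omega>_def c_def e_def)
    then show ?thesis by blast
  qed
  then obtain R' where R': "transport R' J (\<lambda>j. 1 - \<omega> j / \<alpha>) y Z (case_sum c (\<lambda>_. \<beta>)) (case_sum \<zeta> s)" ..
  have finZ: "finite Z" by (simp add: Z_def)

  define A where "A = case_sum (\<lambda>_::nat. 1) (\<lambda>_::nat. 1 - \<beta>)"
  obtain M where M: "transport M I A x (Inl ` {..<p}) (case_sum c (\<lambda>_. \<beta>)) (case_sum \<zeta> s)"
  proof -
    have Z: "Inr ` {..<n} \<union> Inl ` {..<p} = Z" by (auto simp: Z_def)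
    \<comment> \<open>The source and the target indexed by \<open>Inr j\<close> both lie at
      \<open>s j\<close>, so the identity serves as the matching.\<close>
    have "\<exists>M. transport M I (\<lambda>i. if i \<in> id ` Inr ` {..<n} then 1 - \<beta> else 1) x
        (Inl ` {..<p}) (case_sum c (\<lambda>_. \<beta>)) (case_sum \<zeta> s)"
      by (rule transport_cancel_set[OF _ fin(1) _ _ _ _ _ _ _
            transport_trans[OF R R' fin(1,2) finZ, folded Z]])
        (use \<beta> in \<open>auto simp: I_def x_def\<close>)
    then obtain M where M: "transport M I (\<lambda>i. if i \<in> id ` Inr ` {..<n} then 1 - \<beta> else 1) x
        (Inl ` {..<p}) (case_sum c (\<lambda>_. \<beta>)) (case_sum \<zeta> s)" ..
    show thesis
      by (rule that, rule transport_cong[OF M]) (auto simp: A_def I_def)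
  qed
  have \<beta>_eq: "1 - (1 - (real k - 1) / real n) * (1 - 1 / \<alpha>) = 1 - \<beta>"
  proof -
    have "1 - (real k - 1) / real n = real m / real n"
      using n by (simp add: m(1) field_simps)
    then show ?thesis by (simp add: \<beta>_def e_def)
  qed
  have lhs': "lhs f = (\<Sum>i<r. f (v i)) + (1 - \<beta>) * (\<Sum>j<n. f (s j))" for f
    unfolding lhs \<beta>_eq ..

  have major: "lhs f \<le> rhs f" if "convex_on UNIV f" for f
    using transport_convex_le(2)[OF M fin(1) _ that]
    by (simp add: I_def A_def x_def sum.Plus lhs' rhs c_def sum.reindex sum_distrib_left)

  have strict: "collinear (\<zeta> ` {..<p})" if f: "strictly_convex_on UNIV f" and eq: "lhs f = rhs f" for f
  proof -
    have conv: "convex_on UNIV f" by (rule strictly_convex_on_imp_convex_on[OF f])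
    have le1: "(\<Sum>i\<in>I. 1 * f (x i)) \<le> (\<Sum>j\<in>J. (1 - \<omega> j / \<alpha>) * f (y j))"
      by (rule transport_convex_le(2)[OF R fin conv])
    have le2: "(\<Sum>j\<in>J. (1 - \<omega> j / \<alpha>) * f (y j)) \<le>
        (\<Sum>z\<in>Z. case_sum c (\<lambda>_. \<beta>) z * f (case_sum \<zeta> s z))"
      by (rule transport_convex_le(2)[OF R' fin(2) finZ conv])
    \<comment> \<open>Adding \<open>\<beta> * (\<Sum>j<n. f (s j))\<close> to both sides of
      \<open>lhs f = rhs f\<close> undoes the cancellation. The outer terms of \<open>le1\<close>
      and \<open>le2\<close> then agree, so equality holds already for \<open>R\<close>.\<close>
    have "(\<Sum>i\<in>I. 1 * f (x i)) = (\<Sum>i<r. f (v i)) + (\<Sum>j<n. f (s j))"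
      by (simp add: I_def x_def sum.Plus)
    also have "\<dots> = rhs f + \<beta> * (\<Sum>j<n. f (s j))"
      using eq unfolding lhs' by (simp add: algebra_simps)
    also have "\<dots> = (\<Sum>z\<in>Z. case_sum c (\<lambda>_. \<beta>) z * f (case_sum \<zeta> s z))"
      by (simp add: Z_def sum.Plus rhs c_def sum_distrib_left)
    finally have eq': "(\<Sum>i\<in>I. f (x i)) = (\<Sum>j\<in>J. (1 - \<omega> j / \<alpha>) * f (y j))"
      using le1 le2 by simp
    have p: "0 < p" using assms(1,2) by simp
    have "y (Inl l) = y (Inl 0)" if "l < p" for l
    proof (rule transport_strictly_convex_eq_const[OF R fin f eq'])
      show "0 < \<omega> j / \<alpha>" if "j \<in> J" for j using \<omega>[OF that] \<alpha> by simp
      show "(\<Sum>j\<in>J. \<omega> j / \<alpha>) = 1" using \<omega>_sum \<alpha> by (simp flip: sum_divide_distrib)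
    qed (use that p in \<open>auto simp: J_def\<close>)
    then have "\<zeta> l \<in> {\<zeta> 0}" if "l < p" for l
      using that unfolding y_def sum.case by blast
    then have "\<zeta> ` {..<p} \<subseteq> {\<zeta> 0}" by blast
    then show ?thesis by (rule collinear_subset[OF collinear_sing])
  qed

  have D: "D = (real p - 1) * \<alpha> + real m" unfolding D_def m(1) by simp
  have D0: "0 < D"
  proof -
    have "0 < (real p - 1) * \<alpha>" using \<alpha> assms(1,2) by simp
    then show ?thesis unfolding D by simp
  qed
  have majorization: "(Matrix.vec r v @\<^sub>v Matrix.vec n s,
        Matrix.vec r (\<lambda>_. \<alpha> / D) @\<^sub>v
        Matrix.vec n (\<lambda>_. ((real k - 1) * \<alpha> + real n - real k + 1) / (real n * D)))
       \<prec>\<^sub>w (Matrix.vec p \<zeta>, Matrix.vec p (\<lambda>l. (\<alpha> - a l) / D))"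
  proof -
    define h where "h i = (if i < r then Inl i else Inr (i - r))" for i
    have h: "bij_betw h {..<r + n} I"
      by (rule bij_betwI[where g = "case_sum id (\<lambda>j. r + j)"]) (auto simp: h_def I_def)
    have g: "bij_betw Inl {..<p} (Inl ` {..<p} :: (nat + nat) set)"
      by (simp add: bij_betw_def)
    \<comment> \<open>The factor \<open>\<alpha> / D\<close> rescales the plan to total mass
      one.\<close>
    obtain N where N0: "transport N {..<r + n} (\<lambda>i. \<alpha> / D * A (h i)) (\<lambda>i. x (h i)) {..<p} (\<lambda>l. \<alpha> / D * c l) \<zeta>"
      using transport_scale[OF transport_reindex[OF M h g], of "\<alpha> / D"] \<alpha> D0 by auto
    have N: "transport N {..<r + n} (\<lambda>i. \<alpha> / D * A (h i)) (\<lambda>i. x (h i)) {..<p} (\<lambda>l. (\<alpha> - a l) / D) \<zeta>"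
      by (rule transport_cong[OF N0]) (use \<alpha> D0 in \<open>auto simp: c_def field_simps\<close>)
    have "(\<Sum>i<r + n. \<alpha> / D * A (h i)) = (\<Sum>l<p. (\<alpha> - a l) / D)"
      using transport_row[OF N] transport_col[OF N] sum.swap[of N "{..<p}" "{..<r + n}"] by simp
    also have "\<dots> = 1"
    proof -
      \<comment> \<open>Subtracting all the \<open>a l\<close> from one of the \<open>p\<close>
        copies of \<open>\<alpha>\<close> leaves \<open>m\<close>.\<close>
      have "(\<Sum>l<p. \<alpha> - a l) = D"
        unfolding D using \<alpha>_def m(1) by (simp add: sum_subtractf algebra_simps)
      then show ?thesis using D0 by (simp flip: sum_divide_distrib)
    qed
    finally have one: "(\<Sum>i<r + n. \<alpha> / D * A (h i)) = 1" .
    have "0 < \<alpha> / D * A (h i)" for i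
      using \<alpha> D0 \<beta> by (auto simp: A_def h_def)
    from weighted_majorized_of_transport[OF N this one]
    have "(Matrix.vec (r + n) (\<lambda>i. x (h i)), Matrix.vec (r + n) (\<lambda>i. \<alpha> / D * A (h i)))
       \<prec>\<^sub>w (Matrix.vec p \<zeta>, Matrix.vec p (\<lambda>l. (\<alpha> - a l) / D))" .
    moreover have "Matrix.vec (r + n) (\<lambda>i. x (h i)) = Matrix.vec r v @\<^sub>v Matrix.vec n s"
      by (rule eq_vecI) (auto simp: x_def h_def)
    moreover have "\<alpha> / D * (1 - \<beta>) = ((real k - 1) * \<alpha> + real n - real k + 1) / (real n * D)"
      using \<alpha> D0 n unfolding \<beta>_eq[symmetric] by (simp add: field_simps)
    then have "Matrix.vec (r + n) (\<lambda>i. \<alpha> / D * A (h i)) = Matrix.vec r (\<lambda>_. \<alpha> / D) @\<^sub>v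
        Matrix.vec n (\<lambda>_. ((real k - 1) * \<alpha> + real n - real k + 1) / (real n * D))"
      by (intro eq_vecI) (auto simp: A_def h_def)
    ultimately show ?thesis by simp
  qed
  \<comment> \<open>The equivalence holds because both of its sides have been established.\<close>
  show ?thesis unfolding Let_def using major strict majorization by blast
qed

end
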